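(* Any symmetric log-concave probability measure on $\mathbb{R}$ satisfies $\mathrm{IC}(48)$.
   Context: A measure $\mu$ on $\mathbb{R}$ is log-concave if $\mu(tA+(1-t)B)\ge\mu(A)^t\mu(B)^{1-t}$ for all nonempty compact sets $A,B$ and $t\in[0,1]$; it is symmetric if $\mu(-A)=\mu(A)$ for Borel $A$. For functions $f,g$ on $\mathbb{R}$, $f\Box g(x):=\inf\{f(x-y)+g(y): y\in\mathbb{R}\}$. For a probability measure $\mu$ on $\mathbb{R}$ and a measurable $\varphi:\mathbb{R}\to[0,\infty]$, the pair $(\mu,\varphi)$ has property $(\tau)$ if for every bounded measurable $f:\mathbb{R}\to\mathbb{R}$, $\int e^{f\Box\varphi}\,d\mu\int e^{-f}\,d\mu\le 1$. Put $\Lambda_\mu(v)=\log\int_{\mathbb{R}}e^{vx}d\mu(x)$ and $\Lambda_\mu^\star(v)=\sup_{u\in\mathbb{R}}\{vu-\Lambda_\mu(u)\}$. A symmetric probability measure $\mu$ satisfies $\mathrm{IC}(\beta)$, $\beta>0$, if the pair $(\mu,\Lambda_\mu^\star(\cdot/\beta))$ has property $(\tau)$. *)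

theory Defs
  imports "HOL-Probability.Probability"
begin

text \<open>
  Only finite measures are considered, so the real-valued \<^const>\<open>measure\<close> is used.  The library
  convention \<open>0 powr 0 = 0\<close> is harmless: for \<open>t = 0\<close> or \<open>t = 1\<close> the Minkowski combination is
  \<open>B\<close> or \<open>A\<close> itself, so the inequality is trivial under either convention for \<open>0\<^sup>0\<close>.
\<close>

definition log_concave_measure :: "real measure \<Rightarrow> bool" where
  "log_concave_measure M \<longleftrightarrow>
     (\<forall>A B. \<forall>t\<in>{0..1}. compact A \<longrightarrow> A \<noteq> {} \<longrightarrow> compact B \<longrightarrow> B \<noteq> {} \<longrightarrow>
        measure M {t * a + (1 - t) * b | a b. a \<in> A \<and> b \<in> B}
          \<ge> measure M A powr t * measure M B powr (1 - t))"

definition symmetric_measure :: "real measure \<Rightarrow> bool" where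
  "symmetric_measure M \<longleftrightarrow> (\<forall>A\<in>sets borel. measure M (uminus ` A) = measure M A)"

definition inf_convolution :: "(real \<Rightarrow> ereal) \<Rightarrow> (real \<Rightarrow> ereal) \<Rightarrow> real \<Rightarrow> ereal" where
  "inf_convolution f g x = (INF y. f (x - y) + g y)"

definition exp_ereal :: "ereal \<Rightarrow> ennreal" where
  "exp_ereal x = (case x of ereal r \<Rightarrow> ennreal (exp r) | PInfty \<Rightarrow> \<infinity> | MInfty \<Rightarrow> 0)"

definition ln_ennreal :: "ennreal \<Rightarrow> ereal" where
  "ln_ennreal x = (if x = 0 then - \<infinity> else if x = \<infinity> then \<infinity> else ereal (ln (enn2real x)))"

text \<open>
  For Borel \<open>f\<close> and \<open>\<phi>\<close> the sublevel sets of the infimal convolution are projections of Borel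
  sets, hence it is universally measurable, but it need not be Borel.  Its integral is therefore
  taken with respect to the completed measure.
\<close>

definition property_tau :: "real measure \<Rightarrow> (real \<Rightarrow> ereal) \<Rightarrow> bool" where
  "property_tau M \<phi> \<longleftrightarrow>
     \<phi> \<in> borel_measurable borel \<and> (\<forall>x. 0 \<le> \<phi> x) \<and>
     (\<forall>f :: real \<Rightarrow> real. f \<in> borel_measurable borel \<longrightarrow> bounded (range f) \<longrightarrow>
        (\<integral>\<^sup>+ x. exp_ereal (inf_convolution (\<lambda>z. ereal (f z)) \<phi> x) \<partial>(completion M)) *
        (\<integral>\<^sup>+ x. ennreal (exp (- f x)) \<partial>M) \<le> 1)"

definition log_laplace :: "real measure \<Rightarrow> real \<Rightarrow> ereal" where
  "log_laplace M v = ln_ennreal (\<integral>\<^sup>+ x. ennreal (exp (v * x)) \<partial>M)"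

definition log_laplace_conjugate :: "real measure \<Rightarrow> real \<Rightarrow> ereal" where
  "log_laplace_conjugate M v = (SUP u. ereal (v * u) - log_laplace M u)"

definition satisfies_IC :: "real measure \<Rightarrow> real \<Rightarrow> bool" where
  "satisfies_IC M \<beta> \<longleftrightarrow> 0 < \<beta> \<and> property_tau M (\<lambda>v. log_laplace_conjugate M (v / \<beta>))"

end

theory Submission
  imports Defs
begin

text \<open>
  Let \<open>\<mu>\<close> be symmetric and log-concave and let \<open>T x = \<mu> [x, \<infinity>)\<close>.  The idea is to use a coordinate in
  which an exponentially decaying density becomes linear.  If \<open>\<mu>\<close> is not the point mass at \<open>0\<close>,
  it has no atoms, and the coordinate \<open>p \<in> (-1, 1)\<close> of a point \<open>x\<close> is defined by \<open>2 T \<bar>x\<bar> = (1 - \<bar>p\<bar>)\<^sup>2\<close>, with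
  the sign of \<open>x\<close>.  In this coordinate \<open>\<mu>\<close> has the triangular density \<open>1 - \<bar>p\<bar>\<close>.  The midpoint
  Prekopa--Leindler inequality for this density (\<open>prekopa_leindler_midpoint\<close>) is already an
  infimum convolution inequality, with cost \<open>ln (base_ratio p q)\<close>, where \<open>base_ratio p q\<close> is the
  density squared at the midpoint over the product of the densities at \<open>p\<close> and \<open>q\<close>.  It remains to
  compare costs: for the points \<open>x\<close>, \<open>y\<close> with coordinates \<open>p\<close>, \<open>q\<close> one needs
  \<open>\<Lambda>\<^sup>\<star> ((x - y) / 48) \<le> ln (base_ratio p q)\<close>.  The comparison goes through
  \<open>\<tau> = sqrt (2 T a)\<close> with \<open>a = \<bar>x - y\<bar> / 2\<close>.

  On one side, \<open>base_ratio p q \<ge> (1 + \<tau>)\<^sup>2 / (4 \<tau>)\<close> (\<open>tail_ratio_le_base_ratio\<close>).  For points of the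
  same sign this is the submultiplicativity of \<open>2 T\<close> that comes from log-concavity; for points of
  opposite signs one of them is at distance at least \<open>a\<close> from the origin.

  On the other side, \<open>exp (u a / 24) \<le> E exp (u X) * (1 + \<tau>)\<^sup>2 / (4 \<tau>)\<close> for all \<open>u\<close>
  (\<open>mgf_lower_bound\<close>), which bounds \<open>\<Lambda>\<^sup>\<star> (a / 24)\<close>.  If \<open>\<tau> \<le> 1 / 2\<close>, Chernoff's bound
  \<open>E exp (u X) \<ge> exp (u a) T a\<close> is enough.  If \<open>\<tau> > 1 / 2\<close>, a bound that is quadratic in the mass
  \<open>\<epsilon> = 1 - \<tau>\<^sup>2\<close> of \<open>[-a, a]\<close> is needed, because \<open>(1 + \<tau>)\<^sup>2 / (4 \<tau>) - 1\<close> is of order \<open>\<epsilon>\<^sup>2\<close>.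
  Intervals of length \<open>2 a\<close> carry at most as much mass as the centred one, so a fixed proportion of
  the mass lies outside \<open>[-m a, m a]\<close> for some \<open>m\<close> of order \<open>1 / \<epsilon>\<close>, and this forces
  \<open>E exp (u X) = E cosh (u X)\<close> to grow.
\<close>

section \<open>The Prekopa--Leindler inequality on the line\<close>

text \<open>
  Choose \<open>a\<close> in \<open>A\<close> almost at its supremum and \<open>b\<close> in \<open>B\<close> almost at its infimum.  The translates
  \<open>A + b\<close> and \<open>a + B\<close> both lie in \<open>A + B\<close>, and they overlap only in a short interval.
\<close>

lemma brunn_minkowski_midpoint_bounded:
  fixes A B C :: "real set"
  assumes [measurable]: "A \<in> sets borel" "B \<in> sets borel" "C \<in> sets borel"
    and "A \<noteq> {}" "B \<noteq> {}" and bA: "bdd_above A" and bB: "bdd_below B"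
    and mid: "\<And>a b. a \<in> A \<Longrightarrow> b \<in> B \<Longrightarrow> (a + b) / 2 \<in> C"
  shows "emeasure lborel A + emeasure lborel B \<le> 2 * emeasure lborel C"
proof (rule ennreal_le_epsilon)
  fix e :: real assume "0 < e"
  define \<alpha> \<beta> where "\<alpha> = Sup A" and "\<beta> = Inf B"
  obtain a where a: "a \<in> A" "\<alpha> - e / 2 < a"
    using less_cSupD[of A "\<alpha> - e / 2"] \<open>A \<noteq> {}\<close> \<open>0 < e\<close> by (auto simp: \<alpha>_def)
  obtain b where b: "b \<in> B" "b < \<beta> + e / 2"
    using cInf_lessD[of B "\<beta> + e / 2"] \<open>B \<noteq> {}\<close> \<open>0 < e\<close> by (auto simp: \<beta>_def)
  define A' where "A' = (\<lambda>x. -b + x) -` A"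
  define B' where "B' = (\<lambda>x. -a + x) -` B"
  define D where "D = (\<lambda>x. x / 2) -` C"
  have [measurable]: "A' \<in> sets borel" "B' \<in> sets borel" "D \<in> sets borel"
    unfolding A'_def B'_def D_def by (auto intro!: measurable_sets_borel[of _ borel])
  have transl: "emeasure lborel ((\<lambda>x. c + x) -` S) = emeasure lborel S" if "S \<in> sets borel" for c S
  proof -
    have "emeasure (distr lborel borel ((+) c)) S = emeasure lborel S"
      by (simp add: lborel_distr_plus)
    then show ?thesis using that by (subst (asm) emeasure_distr) auto
  qed
  have D: "emeasure lborel D = 2 * emeasure lborel C"
  proof -
    have "emeasure lborel C = emeasure (density (distr lborel borel (\<lambda>x. 0 + (1/2) * x)) (\<lambda>_. ennreal \<bar>1/2\<bar>)) C"
      by (subst lborel_real_affine[of "1/2" 0, symmetric]) auto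
    also have "\<dots> = ennreal (1/2) * emeasure lborel D"
      by (subst emeasure_density_const) (auto simp: emeasure_distr D_def)
    finally have "2 * emeasure lborel C = (2 * ennreal (1/2)) * emeasure lborel D"
      by (simp add: mult.assoc)
    also have "2 * ennreal (1/2) = 1"
      by (metis ennreal_1 ennreal_mult'' ennreal_numeral half_gt_zero less_eq_real_def
          nonzero_mult_div_cancel_left times_divide_eq_right zero_less_one zero_neq_numeral mult.right_neutral)
    finally show ?thesis by simp
  qed
  have sub: "A' \<union> B' \<subseteq> D"
    using a b mid unfolding A'_def B'_def D_def by (force simp: add.commute)
  have "A' \<inter> B' \<subseteq> {a + \<beta> .. \<alpha> + b}"
    unfolding A'_def B'_def
    using cSup_upper[OF _ bA] cInf_lower[OF _ bB] by (force simp: \<alpha>_def \<beta>_def)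
  then have "emeasure lborel (A' \<inter> B') \<le> emeasure lborel {a + \<beta> .. \<alpha> + b}"
    by (intro emeasure_mono) auto
  also have "\<dots> \<le> ennreal e"
    using a b \<open>0 < e\<close> by (auto simp: emeasure_lborel_Icc_eq intro!: ennreal_leI)
  finally have inter: "emeasure lborel (A' \<inter> B') \<le> ennreal e" .
  have "emeasure lborel A + emeasure lborel B = emeasure lborel A' + emeasure lborel B'"
    unfolding A'_def B'_def by (subst (1 2) transl) auto
  also have "\<dots> = emeasure lborel (A' \<union> B') + emeasure lborel (A' \<inter> B')"
    by (rule emeasure_Un_Int) auto
  also have "\<dots> \<le> emeasure lborel D + ennreal e"
    using sub inter by (intro add_mono emeasure_mono) auto
  finally show "emeasure lborel A + emeasure lborel B \<le> 2 * emeasure lborel C + ennreal e"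
    by (simp add: D)
qed

lemma brunn_minkowski_midpoint:
  fixes A B C :: "real set"
  assumes [measurable]: "A \<in> sets borel" "B \<in> sets borel" "C \<in> sets borel"
    and "A \<noteq> {}" "B \<noteq> {}"
    and mid: "\<And>a b. a \<in> A \<Longrightarrow> b \<in> B \<Longrightarrow> (a + b) / 2 \<in> C"
  shows "emeasure lborel A + emeasure lborel B \<le> 2 * emeasure lborel C"
proof -
  obtain a b where ab: "a \<in> A" "b \<in> B" using assms by auto
  define An where "An n = A \<inter> {-real n..real n}" for n
  define Bn where "Bn n = B \<inter> {-real n..real n}" for n
  have lim: "(\<lambda>n. emeasure lborel (S \<inter> {-real n..real n})) \<longlonglongrightarrow> emeasure lborel S"
    if [measurable]: "S \<in> sets borel" for S :: "real set"
  proof -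
    have "(\<Union>n. S \<inter> {-real n..real n}) = S"
    proof (intro equalityI subsetI)
      fix x assume "x \<in> S"
      obtain n where "\<bar>x\<bar> \<le> real n" using real_arch_simple by blast
      with \<open>x \<in> S\<close> show "x \<in> (\<Union>n. S \<inter> {-real n..real n})" by (auto simp: abs_le_iff intro!: exI[of _ n])
    qed auto
    moreover have "incseq (\<lambda>n. S \<inter> {-real n..real n})" by (auto simp: incseq_def)
    ultimately show ?thesis
      using Lim_emeasure_incseq[of "\<lambda>n. S \<inter> {-real n..real n}" lborel] by (simp del: UN_simps add: image_subset_iff)
  qed
  have "(\<lambda>n. emeasure lborel (An n) + emeasure lborel (Bn n)) \<longlonglongrightarrow> emeasure lborel A + emeasure lborel B"
    unfolding An_def Bn_def by (intro tendsto_add lim) auto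
  moreover have "\<forall>\<^sub>F n in sequentially. emeasure lborel (An n) + emeasure lborel (Bn n) \<le> 2 * emeasure lborel C"
  proof -
    obtain n0 where "max \<bar>a\<bar> \<bar>b\<bar> \<le> real n0" using real_arch_simple by blast
    show ?thesis
    proof (rule eventually_sequentiallyI[of n0])
      fix n assume "n0 \<le> n"
      then have "a \<in> An n" "b \<in> Bn n"
        using ab \<open>max \<bar>a\<bar> \<bar>b\<bar> \<le> real n0\<close> of_nat_mono[OF \<open>n0 \<le> n\<close>, where 'a = real] by (auto simp: An_def Bn_def)
      then show "emeasure lborel (An n) + emeasure lborel (Bn n) \<le> 2 * emeasure lborel C"
        using mid
        by (intro brunn_minkowski_midpoint_bounded)
           (auto simp: An_def Bn_def intro: bdd_above_mono[of "{-real n..real n}"] bdd_below_mono[of "{-real n..real n}"])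
    qed
  qed
  ultimately show ?thesis by (intro tendsto_upperbound) auto
qed

lemma layer_cake:
  fixes f :: "real \<Rightarrow> real"
  assumes [measurable]: "f \<in> borel_measurable borel"
  shows "(\<integral>\<^sup>+x. ennreal (f x) \<partial>lborel) =
    (\<integral>\<^sup>+t. emeasure lborel {x. t < f x} * indicator {0..} t \<partial>lborel)"
proof -
  have "(\<integral>\<^sup>+x. ennreal (f x) \<partial>lborel)
      = (\<integral>\<^sup>+x. (\<integral>\<^sup>+t. indicator {x. t < f x} x * indicator {0..} t \<partial>lborel) \<partial>lborel)"
  proof (rule nn_integral_cong)
    fix x
    have "(\<integral>\<^sup>+t. indicator {x. t < f x} x * indicator {0..} t \<partial>lborel)
        = (\<integral>\<^sup>+t. indicator {0..<f x} t \<partial>lborel)"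
      by (intro nn_integral_cong) (auto split: split_indicator)
    also have "\<dots> = ennreal (f x)"
      by (cases "0 \<le> f x") (auto simp: emeasure_lborel_Ico ennreal_neg)
    finally show "ennreal (f x) = (\<integral>\<^sup>+t. indicator {x. t < f x} x * indicator {0..} t \<partial>lborel)" ..
  qed
  also have "\<dots> = (\<integral>\<^sup>+t. (\<integral>\<^sup>+x. indicator {x. t < f x} x * indicator {0..} t \<partial>lborel) \<partial>lborel)"
    by (intro lborel_pair.Fubini') (simp add: indicator_def, measurable)
  also have "\<dots> = (\<integral>\<^sup>+t. emeasure lborel {x. t < f x} * indicator {0..} t \<partial>lborel)"
    by (intro nn_integral_cong) (subst nn_integral_multc, auto)
  finally show ?thesis .
qed

lemma ennreal_arith_geo_mean:
  fixes a b c :: ennreal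
  assumes "a + b \<le> 2 * c"
  shows "a * b \<le> c\<^sup>2"
proof (cases "c = \<top>")
  case False
  then have "2 * c < \<top>" by (simp add: ennreal_mult_less_top less_top)
  then have "a + b < \<top>" using assms by (rule le_less_trans[rotated])
  then obtain x y z where *: "a = ennreal x" "b = ennreal y" "c = ennreal z" "0 \<le> x" "0 \<le> y" "0 \<le> z"
    using False by (cases a; cases b; cases c) auto
  then have "ennreal (x + y) \<le> ennreal (2 * z)"
    using assms by (simp add: ennreal_mult)
  then have le: "x + y \<le> 2 * z" using * by (subst (asm) ennreal_le_iff) auto
  have "4 * (x * y) \<le> (x + y)\<^sup>2" using zero_le_power2[of "x - y"] by (simp add: power2_eq_square algebra_simps)
  also have "\<dots> \<le> (2 * z)\<^sup>2" using le * by (intro power_mono) auto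
  finally have "x * y \<le> z\<^sup>2" by (simp add: power2_eq_square)
  then show ?thesis using * by (simp add: ennreal_mult[symmetric] ennreal_power)
qed (simp add: power2_eq_square)

text \<open>
  After \<open>h\<close> and \<open>k\<close> are scaled to have supremum \<open>1\<close>, their level sets at a height \<open>t < 1\<close> are nonempty
  and those at a height \<open>t \<ge> 1\<close> are empty, so the Brunn--Minkowski inequality applies at every height.
  Integration over the heights gives an arithmetic mean, which is stronger than the geometric mean
  that is claimed.
\<close>

lemma prekopa_leindler_midpoint:
  fixes h k r :: "real \<Rightarrow> real"
  assumes [measurable]: "h \<in> borel_measurable borel" "k \<in> borel_measurable borel" "r \<in> borel_measurable borel"
    and h0: "\<And>x. 0 \<le> h x" and k0: "\<And>x. 0 \<le> k x" and r0: "\<And>x. 0 \<le> r x"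
    and bh: "bdd_above (range h)" and bk: "bdd_above (range k)"
    and mid: "\<And>x y. h x * k y \<le> (r ((x + y) / 2))\<^sup>2"
  shows "(\<integral>\<^sup>+x. ennreal (h x) \<partial>lborel) * (\<integral>\<^sup>+x. ennreal (k x) \<partial>lborel) \<le> (\<integral>\<^sup>+x. ennreal (r x) \<partial>lborel)\<^sup>2"
proof -
  define a b where "a = Sup (range h)" and "b = Sup (range k)"
  have ha: "h x \<le> a" and kb: "k x \<le> b" for x
    using bh bk by (auto simp: a_def b_def intro: cSup_upper)
  show ?thesis
  proof (cases "a = 0 \<or> b = 0")
    case True
    then have "(\<forall>x. h x = 0) \<or> (\<forall>x. k x = 0)"
      using h0 k0 ha kb by (metis order_antisym)
    then show ?thesis by auto
  next
    case False
    then have pos: "0 < a" "0 < b"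
      using h0 k0 ha kb order_trans by (metis order_le_less)+
    define c where "c = sqrt (a * b)"
    have c: "0 < c" "c\<^sup>2 = a * b" using pos by (auto simp: c_def)
    have le: "(\<integral>\<^sup>+x. ennreal (h x / a) \<partial>lborel) + (\<integral>\<^sup>+x. ennreal (k x / b) \<partial>lborel)
        \<le> 2 * (\<integral>\<^sup>+x. ennreal (r x / c) \<partial>lborel)"
    proof -
      have lev: "emeasure lborel {x. t < h x / a} + emeasure lborel {x. t < k x / b}
          \<le> 2 * emeasure lborel {x. t < r x / c}" if "0 \<le> t" for t
      proof (cases "t < 1")
        case True
        have "t * a < a" "t * b < b" using True pos by auto
        then obtain x y where "t * a < h x" "t * b < k y"
          using less_cSupD[of "range h" "t * a"] less_cSupD[of "range k" "t * b"] by (auto simp: a_def b_def)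
        moreover have "t < r ((x + y) / 2) / c" if "t < h x / a" "t < k y / b" for x y
        proof -
          have "t * t < (h x / a) * (k y / b)"
            using that \<open>0 \<le> t\<close> by (intro mult_strict_mono') auto
          also have "\<dots> = h x * k y / c\<^sup>2" using c by simp
          also have "\<dots> \<le> (r ((x + y) / 2) / c)\<^sup>2"
            using mid[of x y] by (simp add: power_divide divide_right_mono)
          finally show ?thesis
            using power2_less_imp_less[of t "r ((x + y) / 2) / c"] r0 c by (simp add: power2_eq_square)
        qed
        ultimately show ?thesis
          using pos by (intro brunn_minkowski_midpoint) (auto simp: pos_less_divide_eq)
      next
        case False
        then have "h x / a \<le> t" "k x / b \<le> t" for x
          using ha[of x] kb[of x] pos by (auto simp: divide_le_eq intro: order_trans[of _ a] order_trans[of _ b])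
        then have "{x. t < h x / a} = {}" "{x. t < k x / b} = {}" by (auto simp: not_less)
        then show ?thesis by simp
      qed
      have "(\<integral>\<^sup>+x. ennreal (h x / a) \<partial>lborel) + (\<integral>\<^sup>+x. ennreal (k x / b) \<partial>lborel)
        = (\<integral>\<^sup>+t. emeasure lborel {x. t < h x / a} * indicator {0..} t
             + emeasure lborel {x. t < k x / b} * indicator {0..} t \<partial>lborel)"
        by (subst (1 2) layer_cake, simp, simp, subst nn_integral_add) auto
      also have "\<dots> \<le> (\<integral>\<^sup>+t. 2 * (emeasure lborel {x. t < r x / c} * indicator {0..} t) \<partial>lborel)"
        using lev by (intro nn_integral_mono) (auto split: split_indicator)
      also have "\<dots> = 2 * (\<integral>\<^sup>+x. ennreal (r x / c) \<partial>lborel)"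
        by (subst nn_integral_cmult, simp, subst layer_cake) auto
      finally show ?thesis .
    qed
    have scale: "(\<integral>\<^sup>+x. ennreal (f x) \<partial>lborel) = ennreal s * (\<integral>\<^sup>+x. ennreal (f x / s) \<partial>lborel)"
      if "0 < s" "f \<in> borel_measurable borel" for s and f :: "real \<Rightarrow> real"
      using that by (subst nn_integral_cmult[symmetric]) (auto simp: ennreal_mult'[symmetric])
    let ?H = "\<integral>\<^sup>+x. ennreal (h x / a) \<partial>lborel" and ?K = "\<integral>\<^sup>+x. ennreal (k x / b) \<partial>lborel"
      and ?R = "\<integral>\<^sup>+x. ennreal (r x / c) \<partial>lborel"
    have "(\<integral>\<^sup>+x. ennreal (h x) \<partial>lborel) * (\<integral>\<^sup>+x. ennreal (k x) \<partial>lborel) = (ennreal a * ennreal b) * (?H * ?K)"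
      using scale[of a h] scale[of b k] pos by (simp add: ac_simps)
    also have "\<dots> \<le> (ennreal a * ennreal b) * ?R\<^sup>2"
      by (intro mult_left_mono ennreal_arith_geo_mean le) auto
    also have "\<dots> = (ennreal c * ?R)\<^sup>2"
      using c pos by (simp add: power_mult_distrib ennreal_power ennreal_mult[symmetric])
    also have "\<dots> = (\<integral>\<^sup>+x. ennreal (r x) \<partial>lborel)\<^sup>2"
      using scale[of c r] c by simp
    finally show ?thesis .
  qed
qed

section \<open>Elementary inequalities\<close>

lemma cosh_ge_quadratic: "1 + x\<^sup>2 / 2 \<le> cosh (x::real)"
proof -
  have *: "1 + y\<^sup>2 / 2 \<le> cosh y" if "0 \<le> y" for y :: real
  proof -
    have "(\<lambda>t. cosh t - (1 + t\<^sup>2 / 2)) 0 \<le> (\<lambda>t. cosh t - (1 + t\<^sup>2 / 2)) y"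
    proof (rule DERIV_nonneg_imp_nondecreasing[OF that])
      fix t :: real assume t: "0 \<le> t"
      have "(\<lambda>t. sinh t - t) 0 \<le> (\<lambda>t. sinh t - t) t"
        by (rule DERIV_nonneg_imp_nondecreasing[OF t])
           (auto intro!: exI derivative_eq_intros simp: cosh_real_ge_1)
      then show "\<exists>d. ((\<lambda>t. cosh t - (1 + t\<^sup>2 / 2)) has_real_derivative d) (at t) \<and> 0 \<le> d"
        by (intro exI[of _ "sinh t - t"]) (auto intro!: derivative_eq_intros)
    qed
    then show ?thesis by simp
  qed
  from *[of "\<bar>x\<bar>"] show ?thesis by simp
qed

text \<open>
  The bound used when \<open>\<tau> > 1 / 2\<close>: the first factor bounds \<open>E cosh (u X)\<close> from below when a
  quarter of the mass lies where \<open>\<bar>u X\<bar> \<ge> \<theta>\<close>, and the second bounds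
  \<open>(1 + \<tau>)\<^sup>2 / (4 \<tau>)\<close> from below when \<open>\<epsilon> = 1 - \<tau>\<^sup>2\<close>.  For
  moderate \<open>\<theta>\<close> all terms are compared up to second order; for large \<open>\<theta>\<close> the exponential growth of
  \<open>cosh\<close> wins alone.
\<close>

lemma exp_product_bound:
  fixes \<theta> \<epsilon> :: real
  assumes "0 \<le> \<theta>" "0 \<le> \<epsilon>" "\<epsilon> \<le> 1"
  shows "exp (\<theta> * \<epsilon> / 9) \<le> (1 + (cosh \<theta> - 1) / 4) * (1 + \<epsilon>\<^sup>2 / 16)"
proof (cases "\<theta> \<le> 9")
  case True
  define z where "z = \<theta> * \<epsilon> / 9"
  have "\<theta> * \<epsilon> \<le> 9 * 1" using assms True by (intro mult_mono) auto
  then have z: "0 \<le> z" "z \<le> 1" using assms by (auto simp: z_def)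
  have "\<theta> * \<epsilon> \<le> \<theta>\<^sup>2 + \<epsilon>\<^sup>2 / 4"
    using zero_le_power2[of "\<theta> - \<epsilon> / 2"] by (simp add: power2_eq_square algebra_simps)
  moreover have "(\<theta> * \<epsilon>)\<^sup>2 \<le> \<theta>\<^sup>2"
    using assms by (simp add: power_mult_distrib mult_left_le power_le_one)
  moreover have "0 \<le> \<epsilon>\<^sup>2" "0 \<le> \<theta>\<^sup>2" by simp_all
  ultimately have "z + z\<^sup>2 \<le> \<theta>\<^sup>2 / 8 + \<epsilon>\<^sup>2 / 16 + \<theta>\<^sup>2 * \<epsilon>\<^sup>2 / 128"
    unfolding z_def power_divide power_mult_distrib by (simp only: zero_le_power2 power2_eq_square[of "9::real"]; linarith)
  then have "1 + z + z\<^sup>2 \<le> (1 + \<theta>\<^sup>2 / 8) * (1 + \<epsilon>\<^sup>2 / 16)"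
    by (simp add: algebra_simps)
  also have "\<dots> \<le> (1 + (cosh \<theta> - 1) / 4) * (1 + \<epsilon>\<^sup>2 / 16)"
    using cosh_ge_quadratic[of \<theta>] by (intro mult_right_mono) auto
  finally show ?thesis using exp_bound[OF z] by (simp add: z_def)
next
  case False
  define y where "y = exp (\<theta> / 9)"
  have y2: "2 \<le> y" using exp_ge_add_one_self[of "\<theta> / 9"] False unfolding y_def by linarith
  have "exp \<theta> = y ^ 9" by (simp add: y_def exp_of_nat_mult[symmetric])
  moreover have "y ^ 9 = y * y ^ 8" by (simp add: eval_nat_numeral)
  moreover have "y * 2 ^ 8 \<le> y * y ^ 8" using y2 by (intro mult_left_mono power_mono) auto
  ultimately have "8 * y \<le> exp \<theta>" using y2 by simp
  moreover have "exp \<theta> / 2 \<le> cosh \<theta>" by (simp add: cosh_field_def)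
  ultimately have "y \<le> 1 + (cosh \<theta> - 1) / 4" by (simp add: field_simps)
  moreover have "exp (\<theta> * \<epsilon> / 9) \<le> y" using assms by (simp add: y_def mult_left_le)
  moreover have "1 + (cosh \<theta> - 1) / 4 \<le> (1 + (cosh \<theta> - 1) / 4) * (1 + \<epsilon>\<^sup>2 / 16)"
    using cosh_real_ge_1[of \<theta>] mult_left_mono[of 1 "1 + \<epsilon>\<^sup>2 / 16" "1 + (cosh \<theta> - 1) / 4"] by simp
  ultimately show ?thesis by linarith
qed

text \<open>
  The bound used when \<open>\<tau> \<le> 1 / 2\<close>; \<open>\<tau>\<^sup>2 / 2\<close> is the tail \<open>T a\<close> of Chernoff's bound.  The inequality
  \<open>(1 + \<tau>)\<^sup>3 \<ge> 27 \<tau> / 4\<close>, with equality at \<open>\<tau> = 1 / 2\<close>, reduces it to the numerical fact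
  \<open>27 ^ 16 \<ge> 2 ^ 75\<close>.
\<close>

lemma tail_ratio_bound:
  fixes \<tau> :: real
  assumes "0 < \<tau>" "\<tau> \<le> 1 / 2"
  shows "(4 * \<tau> / (1 + \<tau>)\<^sup>2) ^ 24 \<le> \<tau>\<^sup>2 / 2"
proof -
  have "0 \<le> (1 - 2 * \<tau>)\<^sup>2 * (\<tau> + 4)" using assms by (intro mult_nonneg_nonneg) auto
  then have "27 / 4 * \<tau> \<le> (1 + \<tau>) ^ 3"
    by (simp add: power2_eq_square power3_eq_cube algebra_simps)
  then have "(27 / 4 * \<tau>) ^ 16 \<le> ((1 + \<tau>) ^ 3) ^ 16" using assms by (intro power_mono) auto
  then have 1: "(27 / 4) ^ 16 * \<tau> ^ 16 \<le> (1 + \<tau>) ^ 48"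
    by (simp only: power_mult[symmetric] power_mult_distrib) simp
  have "\<tau> ^ 6 \<le> (1 / 2) ^ 6" using assms by (intro power_mono) auto
  then have 2: "\<tau> ^ 16 * \<tau> ^ 6 \<le> \<tau> ^ 16 * (1 / 2) ^ 6" using assms by (intro mult_left_mono) auto
  have "2 * (4 * \<tau>) ^ 24 = 2 ^ 49 * (\<tau> ^ 16 * \<tau> ^ 6) * \<tau>\<^sup>2"
    by (simp add: power_mult_distrib power_add[symmetric])
  also have "\<dots> \<le> 2 ^ 49 * (\<tau> ^ 16 * (1 / 2) ^ 6) * \<tau>\<^sup>2"
    by (rule mult_right_mono[OF mult_left_mono[OF 2]]) auto
  also have "\<dots> \<le> (27 / 4) ^ 16 * \<tau> ^ 16 * \<tau>\<^sup>2"
    using assms by (intro mult_right_mono) (auto simp: power_divide)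
  also have "\<dots> \<le> (1 + \<tau>) ^ 48 * \<tau>\<^sup>2"
    using 1 by (intro mult_right_mono) auto
  finally have "2 * (4 * \<tau>) ^ 24 \<le> (1 + \<tau>) ^ 48 * \<tau>\<^sup>2" .
  moreover have "((1 + \<tau>)\<^sup>2) ^ 24 = (1 + \<tau>) ^ 48" by (simp only: power_mult[symmetric]) simp
  ultimately show ?thesis using assms by (simp add: power_divide field_simps)
qed

section \<open>Tails and intervals under a symmetric log-concave measure\<close>

locale symmetric_log_concave = real_distribution M for M :: "real measure" +
  assumes symmetric: "symmetric_measure M"
    and log_concave: "log_concave_measure M"
begin

definition tail :: "real \<Rightarrow> real" where
  "tail x = measure M {x..}"

lemma log_concaveD:
  assumes "0 \<le> t" "t \<le> 1" "compact A" "A \<noteq> {}" "compact B" "B \<noteq> {}" and [measurable]: "D \<in> sets borel"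
    and "\<And>a b. a \<in> A \<Longrightarrow> b \<in> B \<Longrightarrow> t * a + (1 - t) * b \<in> D"
  shows "measure M A powr t * measure M B powr (1 - t) \<le> measure M D"
proof -
  have "measure M A powr t * measure M B powr (1 - t) \<le> measure M {t * a + (1 - t) * b | a b. a \<in> A \<and> b \<in> B}"
    using log_concave assms unfolding log_concave_measure_def by auto
  also have "\<dots> \<le> measure M D"
    using assms by (intro finite_measure_mono) auto
  finally show ?thesis .
qed

lemma measure_reflect:
  assumes "A \<in> sets borel"
  shows "measure M (uminus -` A) = measure M A"
proof -
  have "uminus -` A = uminus ` A" by force
  then show ?thesis using symmetric assms unfolding symmetric_measure_def by simp
qed

lemma tail_antimono: "x \<le> y \<Longrightarrow> tail y \<le> tail x"
  unfolding tail_def by (intro finite_measure_mono) auto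

lemma tail_nonneg: "0 \<le> tail x"
  by (simp add: tail_def)

lemma tail_log_concave:
  assumes "0 \<le> t" "t \<le> 1"
  shows "tail x powr t * tail y powr (1 - t) \<le> tail (t * x + (1 - t) * y)"
proof (cases "0 < tail x \<and> 0 < tail y")
  case True
  have lim: "(\<lambda>n. measure M {x..x + real n}) \<longlonglongrightarrow> tail x" for x
  proof -
    have "(\<Union>n. {x..x + real n}) = {x..}"
    proof (intro equalityI subsetI)
      fix z assume "z \<in> {x..}"
      moreover obtain n where "z - x \<le> real n" using real_arch_simple by blast
      ultimately show "z \<in> (\<Union>n. {x..x + real n})" by (auto intro!: exI[of _ n])
    qed auto
    moreover have "incseq (\<lambda>n. {x..x + real n})" by (auto simp: incseq_def)
    ultimately show ?thesis
      using finite_Lim_measure_incseq[of "\<lambda>n. {x..x + real n}"] by (simp add: tail_def image_subset_iff)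
  qed
  have "(\<lambda>n. measure M {x..x + real n} powr t * measure M {y..y + real n} powr (1 - t))
      \<longlonglongrightarrow> tail x powr t * tail y powr (1 - t)"
    using True by (intro tendsto_intros lim) auto
  moreover have "measure M {x..x + real n} powr t * measure M {y..y + real n} powr (1 - t) \<le> tail (t * x + (1 - t) * y)" for n
    unfolding tail_def using assms
    by (intro log_concaveD) (auto intro!: add_mono mult_left_mono)
  ultimately show ?thesis by (intro LIMSEQ_le_const2) auto
next
  case False
  then have "tail x = 0 \<or> tail y = 0" using tail_nonneg by (metis order_le_less)
  then show ?thesis by (auto simp: tail_nonneg)
qed

text \<open>
  A log-concave function is submultiplicative in this sense: \<open>y\<close> and \<open>x - y\<close> are the two convex
  combinations of \<open>x\<close> and \<open>0\<close> with exchanged weights.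
\<close>

lemma tail_submult:
  assumes "0 \<le> y" "y \<le> x"
  shows "tail x * tail 0 \<le> tail y * tail (x - y)"
proof (cases "x = 0")
  case False
  define t where "t = y / x"
  have t: "0 \<le> t" "t \<le> 1" using assms False by (auto simp: t_def)
  have tx: "t * x = y" using False by (simp add: t_def)
  have "tail x * tail 0 = (tail x powr t * tail 0 powr (1 - t)) * (tail x powr (1 - t) * tail 0 powr (1 - (1 - t)))"
    (is "_ = ?a * ?b")
  proof -
    have "?a * ?b = (tail x powr t * tail x powr (1 - t)) * (tail 0 powr (1 - t) * tail 0 powr (1 - (1 - t)))"
      by (simp only: ac_simps)
    then show ?thesis by (simp add: tail_nonneg flip: powr_add)
  qed
  also have "\<dots> \<le> tail (t * x + (1 - t) * 0) * tail ((1 - t) * x + (1 - (1 - t)) * 0)"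
    using t by (intro mult_mono tail_log_concave) (auto simp: tail_nonneg)
  also have "\<dots> = tail y * tail (x - y)"
    by (simp add: tx left_diff_distrib)
  finally show ?thesis .
qed (use assms in simp)

text \<open>
  The centred interval is the midpoint set of an interval and its reflection, which have equal mass.
\<close>

lemma interval_le_centred:
  assumes "0 \<le> l"
  shows "measure M {b..b + l} \<le> measure M {- l / 2..l / 2}"
proof -
  have "measure M {b..b + l} = measure M {b..b + l} powr (1/2) * measure M {b..b + l} powr (1 - 1/2)"
    by (simp add: powr_add[symmetric])
  also have "measure M {b..b + l} powr (1 - 1/2) = measure M {- (b + l)..- b} powr (1 - 1/2)"
  proof -
    have "uminus -` {b..b + l} = {- (b + l)..- b}" by auto
    then show ?thesis using measure_reflect[of "{b..b + l}"] by simp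
  qed
  also have "measure M {b..b + l} powr (1/2) * \<dots> \<le> measure M {- l / 2..l / 2}"
    using assms by (intro log_concaveD) (auto simp: field_simps)
  finally show ?thesis .
qed

lemma centred_interval_subadditive:
  assumes "0 \<le> a" "0 < m"
  shows "measure M {- (real m * a)..real m * a} \<le> real m * measure M {- a..a}"
proof -
  have *: "measure M {c..c + real (Suc n) * (2 * a)} \<le> real (Suc n) * measure M {- a..a}" for c n
  proof (induction n)
    case 0
    show ?case using interval_le_centred[of "2 * a" c] assms by simp
  next
    case (Suc n)
    have "measure M {c..c + real (Suc (Suc n)) * (2 * a)}
       \<le> measure M ({c..c + real (Suc n) * (2 * a)} \<union> {c + real (Suc n) * (2 * a)..c + real (Suc n) * (2 * a) + 2 * a})"
      by (intro finite_measure_mono) (auto simp: algebra_simps)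
    also have "\<dots> \<le> measure M {c..c + real (Suc n) * (2 * a)}
        + measure M {c + real (Suc n) * (2 * a)..c + real (Suc n) * (2 * a) + 2 * a}"
      by (intro measure_Un_le) auto
    also have "\<dots> \<le> real (Suc n) * measure M {- a..a} + measure M {- a..a}"
      using interval_le_centred[of "2 * a"] assms by (intro add_mono Suc) auto
    finally show ?case by (simp add: algebra_simps)
  qed
  obtain n where "m = Suc n" using assms(2) by (cases m) auto
  then show ?thesis using *[of "- (real m * a)" n] by (simp add: algebra_simps)
qed

text \<open>
  An atom is dominated by the mass of \<open>{0}\<close>.  If some interval \<open>[a, b]\<close> with \<open>a > 0\<close> had positive
  mass as well, log-concavity between \<open>{0}\<close> and \<open>[a, b]\<close> would bound the mass of \<open>[s a, s b]\<close> from
  below uniformly in \<open>s\<close>, although for small \<open>s\<close> these sets lie in \<open>(0, 1 / n]\<close>, whose mass tends to \<open>0\<close>.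
\<close>

lemma atom_imp_dirac:
  assumes "0 < measure M {x}"
  shows "measure M {0} = 1"
proof -
  define m0 where "m0 = measure M {0}"
  have m0: "0 < m0" using interval_le_centred[of 0 x] assms by (simp add: m0_def)
  have inv: "1 / real (Suc n) \<le> 1 / real (Suc m)" if "m \<le> n" for m n
    using that by (intro divide_left_mono) auto
  have null: "measure M {a..b} = 0" if "0 < a" "a \<le> b" for a b
  proof (rule ccontr)
    assume "measure M {a..b} \<noteq> 0"
    define \<eta> where "\<eta> = min m0 (measure M {a..b})"
    have \<eta>: "0 < \<eta>" using m0 \<open>measure M {a..b} \<noteq> 0\<close> by (simp add: \<eta>_def zero_less_measure_iff)
    have le: "\<eta> \<le> measure M {0<..1 / real (Suc n)}" for n
    proof -
      define s where "s = min 1 (1 / (real (Suc n) * b))"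
      have s: "0 < s" "s \<le> 1" using that by (auto simp: s_def)
      have sb: "s * b \<le> 1 / real (Suc n)"
      proof -
        have "s * b \<le> (1 / (real (Suc n) * b)) * b" using that by (intro mult_right_mono) (auto simp: s_def)
        then show ?thesis using that by simp
      qed
      have "\<eta> = \<eta> powr (1 - s) * \<eta> powr (1 - (1 - s))"
        using \<eta> by (simp add: powr_add[symmetric])
      also have "\<dots> \<le> measure M {0} powr (1 - s) * measure M {a..b} powr (1 - (1 - s))"
        using s \<eta> by (intro mult_mono powr_mono2) (auto simp: \<eta>_def m0_def)
      also have "\<dots> \<le> measure M {0<..1 / real (Suc n)}"
      proof (intro log_concaveD)
        fix p q assume "p \<in> {0::real}" "q \<in> {a..b}"
        then have "0 < s * q" "s * q \<le> s * b" using s that by auto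
        then show "(1 - s) * p + (1 - (1 - s)) * q \<in> {0<..1 / real (Suc n)}"
          using sb \<open>p \<in> {0}\<close> by (auto simp del: of_nat_Suc)
      qed (use s that in auto)
      finally show ?thesis .
    qed
    have "(\<Inter>n. {0<..1 / real (Suc n)}) = {}"
    proof safe
      fix z assume z: "z \<in> (\<Inter>n. {0<..1 / real (Suc n)})"
      then have "0 < z" by auto
      then obtain n where "1 / real (Suc n) < z" using nat_approx_posE by blast
      with z show "z \<in> {}" by (auto simp del: of_nat_Suc dest: spec[of _ n])
    qed
    moreover have "decseq (\<lambda>n. {0<..1 / real (Suc n)})"
      unfolding decseq_def
    proof (intro allI impI subsetI)
      fix m n :: nat and z :: real assume "m \<le> n" "z \<in> {0<..1 / real (Suc n)}"
      then show "z \<in> {0<..1 / real (Suc m)}" using inv[of m n] by (simp del: of_nat_Suc)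
    qed
    ultimately have "(\<lambda>n. measure M {0<..1 / real (Suc n)}) \<longlonglongrightarrow> 0"
      using finite_Lim_measure_decseq[of "\<lambda>n. {0<..1 / real (Suc n)}"] by (auto simp: image_subset_iff simp del: of_nat_Suc)
    then have "\<eta> \<le> 0" using le by (intro LIMSEQ_le_const) auto
    then show False using \<eta> by simp
  qed
  have "measure M {0<..} = 0"
  proof -
    have "(\<Union>n. {1 / real (Suc n)..real (Suc n)}) = {0<..}"
    proof (intro equalityI subsetI)
      fix z :: real assume "z \<in> {0<..}"
      then obtain n where n: "1 / real (Suc n) < z" using nat_approx_posE by auto
      obtain m where m: "z \<le> real m" using real_arch_simple by blast
      have "1 / real (Suc (max m n)) \<le> 1 / real (Suc n)" by (intro divide_left_mono) auto
      then have "z \<in> {1 / real (Suc (max m n))..real (Suc (max m n))}" using n m by auto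
      then show "z \<in> (\<Union>n. {1 / real (Suc n)..real (Suc n)})" by blast
    next
      fix z :: real assume "z \<in> (\<Union>n. {1 / real (Suc n)..real (Suc n)})"
      then obtain n where "1 / real (Suc n) \<le> z" by auto
      moreover have "0 < 1 / real (Suc n)" by simp
      ultimately show "z \<in> {0<..}" by (metis greaterThan_iff order_less_le_trans)
    qed
    moreover have "(\<lambda>n. measure M {1 / real (Suc n)..real (Suc n)}) \<longlonglongrightarrow> measure M (\<Union>n. {1 / real (Suc n)..real (Suc n)})"
    proof (intro finite_Lim_measure_incseq)
      show "incseq (\<lambda>n. {1 / real (Suc n)..real (Suc n)})"
        unfolding incseq_def
      proof (intro allI impI subsetI)
        fix m n :: nat and z :: real assume "m \<le> n" "z \<in> {1 / real (Suc m)..real (Suc m)}"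
        moreover have "real (Suc m) \<le> real (Suc n)" using \<open>m \<le> n\<close> by simp
        ultimately show "z \<in> {1 / real (Suc n)..real (Suc n)}"
          using inv[of m n] by (simp del: of_nat_Suc)
      qed
    qed auto
    moreover have "measure M {1 / real (Suc n)..real (Suc n)} = 0" for n
    proof -
      have "1 / real (Suc n) \<le> 1" "1 \<le> real (Suc n)" using inv[of 0 n] by simp_all
      then have "1 / real (Suc n) \<le> real (Suc n)" by linarith
      then show ?thesis by (intro null) auto
    qed
    ultimately show ?thesis using LIMSEQ_unique[OF tendsto_const, of 0] by (auto simp del: of_nat_Suc)
  qed
  moreover have "measure M {..<0} = measure M {0<..}"
    using measure_reflect[of "{0<..}"] by (simp add: vimage_def greaterThan_def lessThan_def)
  moreover have "measure M (({..<0} \<union> {0<..}) \<union> {0}) \<le> (measure M {..<0} + measure M {0<..}) + measure M {0}"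
    by (intro order_trans[OF measure_Un_le] add_mono measure_Un_le) auto
  moreover have "({..<0} \<union> {0<..}) \<union> {0} = (UNIV :: real set)" by auto
  ultimately have "1 \<le> measure M {0}" using prob_space by simp
  then show ?thesis using prob_le_1[of "{0}"] by simp
qed
end

section \<open>Lower bounds for the Laplace transform\<close>

context symmetric_log_concave
begin

lemma distr_uminus: "distr M borel uminus = M"
proof (rule measure_eqI)
  fix A assume "A \<in> sets (distr M borel uminus)"
  then have A: "A \<in> sets borel" by simp
  then have "emeasure (distr M borel uminus) A = emeasure M (uminus -` A)"
    by (subst emeasure_distr) auto
  also have "\<dots> = emeasure M A" using A by (simp add: emeasure_eq_measure measure_reflect)
  finally show "emeasure (distr M borel uminus) A = emeasure M A" .
qed simp

lemma mgf_eq_cosh: "(\<integral>\<^sup>+x. ennreal (exp (u * x)) \<partial>M) = (\<integral>\<^sup>+x. ennreal (cosh (u * x)) \<partial>M)"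
proof -
  have "(\<integral>\<^sup>+x. ennreal (exp (u * x)) \<partial>M) = (\<integral>\<^sup>+x. ennreal (exp (u * x)) \<partial>(distr M borel uminus))"
    by (simp add: distr_uminus)
  also have "\<dots> = (\<integral>\<^sup>+x. ennreal (exp (- (u * x))) \<partial>M)"
    by (subst nn_integral_distr) auto
  finally have "2 * (\<integral>\<^sup>+x. ennreal (exp (u * x)) \<partial>M)
      = (\<integral>\<^sup>+x. ennreal (exp (u * x)) \<partial>M) + (\<integral>\<^sup>+x. ennreal (exp (- (u * x))) \<partial>M)"
    by (simp add: mult_2)
  also have "\<dots> = (\<integral>\<^sup>+x. 2 * ennreal (cosh (u * x)) \<partial>M)"
    by (subst nn_integral_add[symmetric])
       (auto simp: cosh_field_def ennreal_plus[symmetric] ennreal_mult''[symmetric] simp flip: ennreal_numeral simp del: ennreal_plus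
             intro!: nn_integral_cong)
  also have "\<dots> = 2 * (\<integral>\<^sup>+x. ennreal (cosh (u * x)) \<partial>M)"
    by (rule nn_integral_cmult) (simp add: cosh_field_def)
  finally show ?thesis by (simp add: ennreal_mult_cancel_left)
qed

lemma mgf_ge_1: "1 \<le> (\<integral>\<^sup>+x. ennreal (exp (u * x)) \<partial>M)"
proof -
  have "1 = (\<integral>\<^sup>+x. 1 \<partial>M)" using emeasure_space_1 by simp
  also have "\<dots> \<le> (\<integral>\<^sup>+x. ennreal (cosh (u * x)) \<partial>M)"
    by (intro nn_integral_mono) (simp add: cosh_real_ge_1)
  finally show ?thesis by (simp add: mgf_eq_cosh)
qed

lemma mgf_ge_tail:
  assumes "0 \<le> u"
  shows "ennreal (exp (u * a) * tail a) \<le> (\<integral>\<^sup>+x. ennreal (exp (u * x)) \<partial>M)"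
proof -
  have "ennreal (exp (u * a) * tail a) = (\<integral>\<^sup>+x. ennreal (exp (u * a)) * indicator {a..} x \<partial>M)"
    by (subst nn_integral_cmult_indicator) (auto simp: tail_def emeasure_eq_measure ennreal_mult')
  also have "\<dots> \<le> (\<integral>\<^sup>+x. ennreal (exp (u * x)) \<partial>M)"
    using assms by (intro nn_integral_mono) (auto split: split_indicator intro!: ennreal_leI mult_left_mono)
  finally show ?thesis .
qed

lemma mgf_ge_cosh:
  assumes "0 \<le> b"
  shows "ennreal (1 + (cosh (u * b) - 1) * (1 - measure M {- b..b})) \<le> (\<integral>\<^sup>+x. ennreal (exp (u * x)) \<partial>M)"
proof -
  let ?c = "cosh (u * b) - 1"
  have c: "0 \<le> ?c" by (simp add: cosh_real_ge_1)
  have "ennreal (1 + ?c * (1 - measure M {- b..b})) = 1 + ennreal ?c * emeasure M (- {- b..b})"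
    using c prob_compl[of "{-b..b}"] prob_le_1[of "{-b..b}"]
    by (simp add: emeasure_eq_measure ennreal_mult'[symmetric] Compl_eq_Diff_UNIV ennreal_plus)
  also have "\<dots> = (\<integral>\<^sup>+x. 1 + ennreal ?c * indicator (- {- b..b}) x \<partial>M)"
    using emeasure_space_1 by (subst nn_integral_add) (auto simp: nn_integral_cmult_indicator)
  also have "\<dots> \<le> (\<integral>\<^sup>+x. ennreal (cosh (u * x)) \<partial>M)"
  proof (intro nn_integral_mono)
    fix x
    have "cosh (u * b) \<le> cosh (u * x)" if "x \<notin> {- b..b}"
    proof -
      have "\<bar>u * b\<bar> \<le> \<bar>u * x\<bar>"
        using that assms by (auto simp: abs_mult intro!: mult_left_mono)
      then have "cosh \<bar>u * b\<bar> \<le> cosh \<bar>u * x\<bar>" by (subst cosh_real_nonneg_le_iff) auto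
      then show ?thesis by simp
    qed
    moreover have sum: "1 + ennreal ?c = ennreal (cosh (u * b))"
      using ennreal_plus[of 1 ?c] c by simp
    ultimately show "1 + ennreal ?c * indicator (- {- b..b}) x \<le> ennreal (cosh (u * x))"
      using c sum by (auto split: split_indicator simp: cosh_real_ge_1 intro!: ennreal_leI)
  qed
  finally show ?thesis by (simp add: mgf_eq_cosh)
qed

context
  assumes nondegenerate: "measure M {0} \<noteq> 1"
begin

lemma atomless: "measure M {x} = 0"
  using atom_imp_dirac[of x] nondegenerate by (metis zero_less_measure_iff)

lemma cdf_eq_tail: "cdf M x = tail (- x)"
proof -
  have "uminus -` {..x} = {- x..}" by auto
  then show ?thesis using measure_reflect[of "{..x}"] by (simp add: cdf_def tail_def)
qed

lemma cdf_plus_tail: "cdf M x + tail x = 1"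
proof -
  have "measure M ({..<x} \<union> {x}) = measure M {..<x} + measure M {x}"
    by (intro finite_measure_Union) auto
  moreover have "{..<x} \<union> {x} = {..x}" by auto
  moreover have "measure M ({..<x} \<union> {x..}) = measure M {..<x} + measure M {x..}"
    by (intro finite_measure_Union) auto
  moreover have "{..<x} \<union> {x..} = UNIV" by auto
  ultimately show ?thesis using prob_space by (simp add: cdf_def tail_def atomless)
qed

lemma tail_minus: "tail (- x) = 1 - tail x"
  using cdf_eq_tail cdf_plus_tail by (metis add_diff_cancel_right')

lemma tail_0: "tail 0 = 1 / 2"
  using tail_minus[of 0] by simp

lemma tail_le_half: "0 \<le> x \<Longrightarrow> tail x \<le> 1 / 2"
  using tail_antimono[of 0 x] by (simp add: tail_0)

lemma measure_centred:
  assumes "0 \<le> a"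
  shows "measure M {- a..a} = 1 - 2 * tail a"
proof -
  have "measure M ({- a..a} \<union> {a<..}) = measure M {- a..a} + measure M {a<..}"
    by (intro finite_measure_Union) auto
  moreover have "{- a..a} \<union> {a<..} = {- a..}" using assms by auto
  moreover have "measure M ({a} \<union> {a<..}) = measure M {a} + measure M {a<..}"
    by (intro finite_measure_Union) auto
  moreover have "{a} \<union> {a<..} = {a..}" by auto
  ultimately show ?thesis using tail_minus[of a] by (simp add: tail_def atomless)
qed

lemma measure_centred_pos:
  assumes "0 < a"
  shows "0 < measure M {- a..a}"
proof (rule ccontr)
  assume "\<not> 0 < measure M {- a..a}"
  then have 0: "measure M {- a..a} = 0" using zero_less_measure_iff by blast
  have "measure M {- (real n * a)..real n * a} = 0" for n
    using centred_interval_subadditive[of a n] atomless[of 0] assms 0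
    by (cases "n = 0") (auto simp: measure_le_0_iff)
  moreover have "(\<lambda>n. measure M {- (real n * a)..real n * a}) \<longlonglongrightarrow> measure M (\<Union>n. {- (real n * a)..real n * a})"
  proof (intro finite_Lim_measure_incseq)
    show "incseq (\<lambda>n. {- (real n * a)..real n * a})"
      unfolding incseq_def
    proof (intro allI impI subsetI)
      fix m n :: nat and z assume "m \<le> n" "z \<in> {- (real m * a)..real m * a}"
      moreover have "real m * a \<le> real n * a" using \<open>m \<le> n\<close> assms by (intro mult_right_mono) auto
      ultimately show "z \<in> {- (real n * a)..real n * a}" by auto
    qed
  qed auto
  moreover have "(\<Union>n. {- (real n * a)..real n * a}) = UNIV"
  proof (intro equalityI subsetI)
    fix z :: real
    obtain n where "\<bar>z\<bar> \<le> real n * a"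
      using reals_Archimedean3[OF assms] less_imp_le by blast
    then show "z \<in> (\<Union>n. {- (real n * a)..real n * a})" by (auto simp: abs_le_iff intro!: exI[of _ n])
  qed auto
  ultimately have "measure M UNIV = 0" using LIMSEQ_unique[OF tendsto_const, of 0] by auto
  then show False using prob_space by simp
qed

text \<open>
  For \<open>\<tau> \<le> 1 / 2\<close> it suffices to compare the 24th powers, since \<open>E exp (u X) \<ge> 1\<close>.  For \<open>\<tau> > 1 / 2\<close>
  the mass \<open>\<epsilon>\<close> of \<open>[-a, a]\<close> is at most \<open>3 / 4\<close>, and \<open>m\<close> is the largest integer with
  \<open>m \<epsilon> \<le> 3 / 4\<close>, so that at least a quarter of the mass lies outside \<open>[-m a, m a]\<close>, while
  \<open>m \<epsilon> \<ge> 3 / 8\<close> gives \<open>u a / 24 \<le> \<theta> \<epsilon> / 9\<close> for \<open>\<theta> = u m a\<close>.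
\<close>

lemma mgf_lower_bound_nonneg:
  assumes "0 \<le> u" "0 < a" "0 < tail a"
  defines "\<tau> \<equiv> sqrt (2 * tail a)"
  shows "ennreal (exp (u * a / 24)) \<le> (\<integral>\<^sup>+x. ennreal (exp (u * x)) \<partial>M) * ennreal ((1 + \<tau>)\<^sup>2 / (4 * \<tau>))"
proof (cases "\<integral>\<^sup>+x. ennreal (exp (u * x)) \<partial>M")
  case top
  have "0 < \<tau>" using assms by simp
  then have "0 < (1 + \<tau>)\<^sup>2 / (4 * \<tau>)" by simp
  then show ?thesis using \<open>0 < \<tau>\<close> by (simp add: top ennreal_top_mult)
next
  case (real E)
  have \<tau>: "0 < \<tau>" "\<tau> \<le> 1" "\<tau>\<^sup>2 = 2 * tail a"
    using assms tail_le_half[of a] by (auto simp: \<tau>_def)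
  have E1: "1 \<le> E" using mgf_ge_1[of u] real by (simp flip: ennreal_1)
  have "exp (u * a / 24) \<le> E * ((1 + \<tau>)\<^sup>2 / (4 * \<tau>))"
  proof (cases "\<tau> \<le> 1 / 2")
    case True
    have "(exp (u * a / 24) * (4 * \<tau> / (1 + \<tau>)\<^sup>2)) ^ 24 = exp (u * a) * (4 * \<tau> / (1 + \<tau>)\<^sup>2) ^ 24"
      by (subst power_mult_distrib) (simp add: exp_of_nat_mult[symmetric])
    also have "\<dots> \<le> exp (u * a) * (\<tau>\<^sup>2 / 2)"
      using \<tau> True by (intro mult_left_mono tail_ratio_bound) auto
    also have "\<dots> \<le> E"
      using mgf_ge_tail[of u a] assms real \<tau> by (simp add: ennreal_le_iff)
    also have "\<dots> \<le> E ^ 24" using E1 self_le_power[of E 24] by simp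
    finally have "exp (u * a / 24) * (4 * \<tau> / (1 + \<tau>)\<^sup>2) \<le> E"
      using power_le_imp_le_base[of _ 23 E] real by simp
    then show ?thesis using \<tau> by (simp add: field_simps)
  next
    case False
    define \<epsilon> where "\<epsilon> = 1 - \<tau>\<^sup>2"
    have meas: "measure M {- a..a} = \<epsilon>" using measure_centred[of a] assms \<tau> by (simp add: \<epsilon>_def)
    have "(1 / 2)\<^sup>2 \<le> \<tau>\<^sup>2" using False by (intro power_mono) auto
    then have \<epsilon>: "0 < \<epsilon>" "\<epsilon> \<le> 3 / 4"
      using measure_centred_pos[of a] assms meas by (auto simp: \<epsilon>_def power2_eq_square)
    define r where "r = 3 / (4 * \<epsilon>)"
    define m where "m = nat \<lfloor>r\<rfloor>"
    have r: "1 \<le> r" "r * \<epsilon> = 3 / 4" using \<epsilon> by (simp_all add: r_def field_simps)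
    then have "1 \<le> \<lfloor>r\<rfloor>" by simp
    then have "real m = of_int \<lfloor>r\<rfloor>" by (simp add: m_def)
    moreover have "1 \<le> real_of_int \<lfloor>r\<rfloor>" using \<open>1 \<le> \<lfloor>r\<rfloor>\<close> by simp
    ultimately have m: "1 \<le> real m" "real m \<le> r" "r \<le> 2 * real m"
      using floor_correct[of r] by linarith+
    have m1: "real m * \<epsilon> \<le> 3 / 4" and m2: "3 / 8 \<le> real m * \<epsilon>"
      using mult_right_mono[OF m(2), of \<epsilon>] mult_right_mono[OF m(3), of \<epsilon>] r(2) \<epsilon> by auto
    define \<theta> where "\<theta> = u * (real m * a)"
    have \<theta>: "0 \<le> \<theta>" using assms by (simp add: \<theta>_def)
    have "measure M {- (real m * a)..real m * a} \<le> 3 / 4"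
      using centred_interval_subadditive[of a m] m m1 assms meas by auto
    then have "1 + (cosh \<theta> - 1) / 4 \<le> 1 + (cosh \<theta> - 1) * (1 - measure M {- (real m * a)..real m * a})"
      using mult_left_mono[of "1 / 4" "1 - measure M {- (real m * a)..real m * a}" "cosh \<theta> - 1"]
      by (simp add: cosh_real_ge_1)
    also have "\<dots> \<le> E"
      using mgf_ge_cosh[of "real m * a" u] assms real by (simp add: \<theta>_def)
    finally have E: "1 + (cosh \<theta> - 1) / 4 \<le> E" .
    have "u * a * (3 / 8) \<le> u * a * (real m * \<epsilon>)"
      using m2 assms by (intro mult_left_mono) auto
    then have "exp (u * a / 24) \<le> exp (\<theta> * \<epsilon> / 9)" by (simp add: \<theta>_def mult.commute mult.left_commute)
    also have "\<dots> \<le> (1 + (cosh \<theta> - 1) / 4) * (1 + \<epsilon>\<^sup>2 / 16)"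
      using \<theta> \<epsilon> by (intro exp_product_bound) auto
    also have "\<dots> \<le> E * ((1 + \<tau>)\<^sup>2 / (4 * \<tau>))"
    proof (intro mult_mono E)
      have "\<epsilon>\<^sup>2 = (1 - \<tau>)\<^sup>2 * (1 + \<tau>)\<^sup>2" by (simp add: \<epsilon>_def power2_eq_square algebra_simps)
      also have "\<dots> \<le> (1 - \<tau>)\<^sup>2 * 2\<^sup>2" using \<tau> by (intro mult_left_mono power_mono) auto
      finally have "\<epsilon>\<^sup>2 / 16 \<le> (1 - \<tau>)\<^sup>2 / 4" by simp
      also have "\<dots> \<le> (1 - \<tau>)\<^sup>2 / (4 * \<tau>)" using \<tau> by (intro divide_left_mono) auto
      also have "\<dots> = (1 + \<tau>)\<^sup>2 / (4 * \<tau>) - 1" using \<tau> by (simp add: field_simps power2_eq_square)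
      finally show "1 + \<epsilon>\<^sup>2 / 16 \<le> (1 + \<tau>)\<^sup>2 / (4 * \<tau>)" by simp
    qed (use real in auto)
    finally show ?thesis .
  qed
  then show ?thesis using real \<tau> by (simp add: ennreal_mult'[symmetric] ennreal_leI)
qed

lemma mgf_lower_bound:
  assumes "0 \<le> a" "0 < tail a"
  defines "\<tau> \<equiv> sqrt (2 * tail a)"
  shows "ennreal (exp (u * a / 24)) \<le> (\<integral>\<^sup>+x. ennreal (exp (u * x)) \<partial>M) * ennreal ((1 + \<tau>)\<^sup>2 / (4 * \<tau>))"
proof (cases "a = 0")
  case True
  then have "\<tau> = 1" by (simp add: \<tau>_def tail_0)
  then show ?thesis using True mgf_ge_1[of u] by simp
next
  case False
  have "ennreal (exp (u * a / 24)) \<le> ennreal (exp (\<bar>u\<bar> * a / 24))"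
    using assms by (intro ennreal_leI) (auto intro: mult_right_mono)
  also have "\<dots> \<le> (\<integral>\<^sup>+x. ennreal (exp (\<bar>u\<bar> * x)) \<partial>M) * ennreal ((1 + \<tau>)\<^sup>2 / (4 * \<tau>))"
    unfolding \<tau>_def using assms False by (intro mgf_lower_bound_nonneg) auto
  also have "(\<integral>\<^sup>+x. ennreal (exp (\<bar>u\<bar> * x)) \<partial>M) = (\<integral>\<^sup>+x. ennreal (exp (u * x)) \<partial>M)"
    unfolding mgf_eq_cosh by (cases "0 \<le> u") auto
  finally show ?thesis .
qed

end
end

section \<open>The triangular coordinate\<close>

text \<open>
  The distribution function, on \<open>[-1, 1]\<close>, of the triangular density \<open>1 - \<bar>p\<bar>\<close>.
\<close>

definition base_cdf :: "real \<Rightarrow> real" where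
  "base_cdf p = 1 / 2 + p - p * \<bar>p\<bar> / 2"

lemma base_cdf_has_derivative: "(base_cdf has_real_derivative 1 - \<bar>p\<bar>) (at p)"
proof -
  have "((\<lambda>x. x * \<bar>x\<bar>) has_real_derivative 2 * \<bar>p\<bar>) (at p)"
  proof (cases p "0 :: real" rule: linorder_cases)
    case greater
    have "((\<lambda>x. x * x) has_real_derivative 2 * \<bar>p\<bar>) (at p)"
      using greater by (auto intro!: derivative_eq_intros)
    then show ?thesis
      by (rule has_field_derivative_transform_within_open[of _ _ _ "{0<..}"]) (use greater in auto)
  next
    case less
    have "((\<lambda>x. - (x * x)) has_real_derivative 2 * \<bar>p\<bar>) (at p)"
      using less by (auto intro!: derivative_eq_intros)
    then show ?thesis
      by (rule has_field_derivative_transform_within_open[of _ _ _ "{..<0}"]) (use less in auto)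
  next
    case equal
    have "((\<lambda>h::real. \<bar>h\<bar>) \<longlongrightarrow> \<bar>0\<bar>) (at 0)" by (intro tendsto_intros)
    then have "((\<lambda>h::real. h * \<bar>h\<bar> / h) \<longlongrightarrow> 0) (at 0)"
      by (rule filterlim_cong[THEN iffD1, rotated -1]) (auto simp: eventually_at_filter)
    then show ?thesis by (simp add: equal DERIV_def)
  qed
  from DERIV_diff[OF DERIV_add[OF DERIV_const[of "1 / 2"] DERIV_ident] DERIV_cdivide[OF this, of 2]]
  show ?thesis by (simp add: base_cdf_def[abs_def])
qed

lemma base_cdf_measurable[measurable]: "base_cdf \<in> borel_measurable borel"
  unfolding base_cdf_def[abs_def] by measurable

lemma base_cdf_nonneg: "0 \<le> p \<Longrightarrow> base_cdf p = 1 - (1 - p)\<^sup>2 / 2"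
  by (simp add: base_cdf_def power2_eq_square field_simps)

lemma base_cdf_nonpos: "p \<le> 0 \<Longrightarrow> base_cdf p = (1 + p)\<^sup>2 / 2"
  by (simp add: base_cdf_def power2_eq_square field_simps)

lemma base_cdf_bounds:
  assumes "p \<in> {-1<..<1}"
  shows "0 < base_cdf p" "base_cdf p < 1"
proof -
  have *: "0 < (1 - t)\<^sup>2" "(1 - t)\<^sup>2 \<le> 1" if "0 \<le> t" "t < 1" for t :: real
    using that by (auto simp: power_le_one)
  show "0 < base_cdf p" "base_cdf p < 1"
    using *[of p] *[of "- p"] assms by (cases "0 \<le> p"; simp add: base_cdf_nonneg base_cdf_nonpos)+
qed

lemma power_mean_ratio_antimono:
  fixes s t :: real
  assumes "0 < s" "s \<le> t" "t \<le> 1"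
  shows "(1 + t)\<^sup>2 / (4 * t) \<le> (1 + s)\<^sup>2 / (4 * s)"
proof -
  have "s * t \<le> 1" using assms mult_mono[of s 1 t 1] by simp
  then have "0 \<le> (t - s) * (1 - s * t)" using assms by simp
  also have "\<dots> = (1 + s)\<^sup>2 * t - (1 + t)\<^sup>2 * s" by (simp add: power2_eq_square algebra_simps)
  finally show ?thesis using assms by (simp add: field_simps)
qed

text \<open>
  The exponential of the cost that the midpoint Prekopa--Leindler inequality yields for the
  triangular density.  For \<open>p\<close>, \<open>q\<close> of equal signs and \<open>1 - \<bar>p\<bar> = s\<close>, \<open>1 - \<bar>q\<bar> = t\<close> it is
  \<open>(1 + s / t)\<^sup>2 / (4 (s / t))\<close>.
\<close>

definition base_ratio :: "real \<Rightarrow> real \<Rightarrow> real" where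
  "base_ratio p q = (1 - \<bar>(p + q) / 2\<bar>)\<^sup>2 / ((1 - \<bar>p\<bar>) * (1 - \<bar>q\<bar>))"

lemma base_ratio_commute: "base_ratio p q = base_ratio q p"
  by (simp add: base_ratio_def ac_simps)

lemma base_ratio_ge_1:
  assumes "p \<in> {-1<..<1}" "q \<in> {-1<..<1}"
  shows "1 \<le> base_ratio p q"
proof -
  have pos: "0 < 1 - \<bar>p\<bar>" "0 < 1 - \<bar>q\<bar>" using assms by auto
  have "(1 - \<bar>p\<bar>) * (1 - \<bar>q\<bar>) \<le> (((1 - \<bar>p\<bar>) + (1 - \<bar>q\<bar>)) / 2)\<^sup>2"
    using zero_le_power2[of "\<bar>p\<bar> - \<bar>q\<bar>"] by (simp add: power2_eq_square field_simps)
  also have "\<dots> \<le> (1 - \<bar>(p + q) / 2\<bar>)\<^sup>2" using pos by (intro power_mono) auto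
  finally show ?thesis using pos by (simp add: base_ratio_def)
qed

context symmetric_log_concave
begin

sublocale cdf_distribution M ..

text \<open>
  The nondecreasing map that transports the triangular density to \<open>M\<close>.
\<close>

definition quantile :: "real \<Rightarrow> real" where
  "quantile p = I (base_cdf p)"

lemma quantile_le_iff: "p \<in> {-1<..<1} \<Longrightarrow> quantile p \<le> x \<longleftrightarrow> base_cdf p \<le> cdf M x"
  using pseudoinverse[of "base_cdf p" x] base_cdf_bounds[of p] by (simp add: quantile_def)

lemma quantile_measurable:
  fixes g :: "real \<Rightarrow> ennreal"
  assumes [measurable]: "g \<in> borel_measurable borel"
  shows "(\<lambda>p. g (quantile p) * indicator {-1<..<1} p) \<in> borel_measurable borel"
    and "(\<lambda>\<omega>. g (I \<omega>) * indicator {0<..<1} \<omega>) \<in> borel_measurable borel"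
proof -
  have "(\<lambda>\<omega>. g (I \<omega>)) \<in> borel_measurable (restrict_space borel {0<..<1})"
    using measurable_CI by measurable
  then show f[measurable]: "(\<lambda>\<omega>. g (I \<omega>) * indicator {0<..<1} \<omega>) \<in> borel_measurable borel"
    by (subst (asm) borel_measurable_restrict_space_iff_ennreal) auto
  have "(\<lambda>p. (g (I (base_cdf p)) * indicator {0<..<1} (base_cdf p)) * indicator {-1<..<1} p) \<in> borel_measurable borel"
    using measurable_compose[OF base_cdf_measurable f] by measurable
  also have "(\<lambda>p. (g (I (base_cdf p)) * indicator {0<..<1} (base_cdf p)) * indicator {-1<..<1} p)
      = (\<lambda>p. g (quantile p) * indicator {-1<..<1} p)"
    using base_cdf_bounds by (auto simp: quantile_def fun_eq_iff split: split_indicator)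
  finally show "(\<lambda>p. g (quantile p) * indicator {-1<..<1} p) \<in> borel_measurable borel" .
qed

lemma nn_integral_quantile:
  fixes g :: "real \<Rightarrow> ennreal"
  assumes [measurable]: "g \<in> borel_measurable borel"
  shows "(\<integral>\<^sup>+x. g x \<partial>M) = (\<integral>\<^sup>+p. g (quantile p) * ennreal (1 - \<bar>p\<bar>) * indicator {-1<..<1} p \<partial>lborel)"
proof -
  let ?f = "\<lambda>\<omega>. g (I \<omega>) * indicator {0<..<1} \<omega>"
  have "(\<integral>\<^sup>+x. g x \<partial>M) = (\<integral>\<^sup>+x. g x \<partial>(distr (restrict_space lborel {0<..<1::real}) borel I))"
    by (simp only: distr_I_eq_M)
  also have "\<dots> = (\<integral>\<^sup>+\<omega>. g (I \<omega>) \<partial>(restrict_space lborel {0<..<1}))"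
  proof (rule nn_integral_distr)
    show "I \<in> restrict_space lborel {0<..<1} \<rightarrow>\<^sub>M borel"
      using measurable_CI by (simp cong: measurable_cong_sets add: sets_restrict_space)
  qed simp
  also have "\<dots> = (\<integral>\<^sup>+\<omega>. ?f \<omega> \<partial>lborel)"
    by (rule nn_integral_restrict_space) simp
  also have "\<dots> = (\<integral>\<^sup>+\<omega>. ?f \<omega> * indicator {base_cdf (-1)..base_cdf 1} \<omega> \<partial>lborel)"
    by (intro nn_integral_cong) (auto simp: base_cdf_def split: split_indicator)
  also have "\<dots> = (\<integral>\<^sup>+p. ?f (base_cdf p) * ennreal (1 - \<bar>p\<bar>) * indicator {-1..1} p \<partial>lborel)"
    by (rule nn_integral_substitution_aux[OF quantile_measurable(2)])
       (auto intro!: base_cdf_has_derivative continuous_intros)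
  also have "\<dots> = (\<integral>\<^sup>+p. g (quantile p) * ennreal (1 - \<bar>p\<bar>) * indicator {-1<..<1} p \<partial>lborel)"
  proof (rule nn_integral_cong)
    fix p
    show "?f (base_cdf p) * ennreal (1 - \<bar>p\<bar>) * indicator {-1..1} p
        = g (quantile p) * ennreal (1 - \<bar>p\<bar>) * indicator {-1<..<1} p"
      using base_cdf_bounds[of p]
      by (cases "p \<in> {-1<..<1}") (auto simp: quantile_def base_cdf_def split: split_indicator)
  qed
  finally show ?thesis .
qed

lemma quantile_degenerate:
  assumes "measure M {0} = 1" "p \<in> {-1<..<1}"
  shows "quantile p = 0"
proof -
  have "cdf M 0 = 1"
    using finite_measure_mono[of "{0}" "{..0}"] assms(1) prob_le_1[of "{..0}"] by (simp add: cdf_def)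
  then have "quantile p \<le> 0"
    using base_cdf_bounds[OF assms(2)] by (subst quantile_le_iff[OF assms(2)]) simp
  moreover have "\<not> quantile p < 0"
  proof
    assume "quantile p < 0"
    have "base_cdf p \<le> cdf M (quantile p)" using quantile_le_iff[OF assms(2)] by blast
    also have "\<dots> \<le> measure M (- {0})"
      unfolding cdf_def using \<open>quantile p < 0\<close> by (intro finite_measure_mono) auto
    also have "\<dots> = 0" using prob_compl[of "{0}"] assms(1) by (simp add: Compl_eq_Diff_UNIV)
    finally show False using base_cdf_bounds[OF assms(2)] by simp
  qed
  ultimately show ?thesis by simp
qed

context
  assumes nondegenerate: "measure M {0} \<noteq> 1"
begin

text \<open>
  Without atoms the distribution function is continuous, hence attains every level.
\<close>

lemma cdf_quantile:
  assumes "p \<in> {-1<..<1}"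
  shows "cdf M (quantile p) = base_cdf p"
proof (rule antisym)
  show "base_cdf p \<le> cdf M (quantile p)" using quantile_le_iff[OF assms] by blast
  show "cdf M (quantile p) \<le> base_cdf p"
  proof (rule ccontr)
    assume "\<not> cdf M (quantile p) \<le> base_cdf p"
    then have lt: "base_cdf p < cdf M (quantile p)" by simp
    have "isCont (cdf M) (quantile p)" using atomless[OF nondegenerate] by (simp add: isCont_cdf)
    then have "(cdf M \<longlongrightarrow> cdf M (quantile p)) (at_left (quantile p))"
      by (auto simp: isCont_def intro: filterlim_at_split[THEN iffD1, THEN conjunct1])
    then have "\<forall>\<^sub>F x in at_left (quantile p). base_cdf p < cdf M x" using lt by (rule order_tendstoD)
    moreover have "\<forall>\<^sub>F x in at_left (quantile p). x < quantile p" by (auto simp: eventually_at_filter)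
    ultimately have "\<forall>\<^sub>F x in at_left (quantile p). base_cdf p < cdf M x \<and> x < quantile p"
      by (rule eventually_conj)
    then obtain x where "base_cdf p < cdf M x" "x < quantile p"
      using eventually_happens'[OF trivial_limit_at_left_real] by blast
    then show False using quantile_le_iff[OF assms, of x] by simp
  qed
qed

lemma tail_quantile:
  assumes "p \<in> {-1<..<1}"
  shows "2 * tail \<bar>quantile p\<bar> = (1 - \<bar>p\<bar>)\<^sup>2"
proof -
  let ?x = "quantile p"
  have t: "tail (- ?x) = base_cdf p" "tail ?x = 1 - base_cdf p"
    using cdf_quantile[OF assms] cdf_eq_tail[OF nondegenerate, of ?x] cdf_plus_tail[OF nondegenerate, of ?x] by auto
  have "tail \<bar>?x\<bar> = min (tail ?x) (tail (- ?x))"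
    using tail_antimono[of ?x "- ?x"] tail_antimono[of "- ?x" ?x] by (auto simp: abs_if min_def)
  also have "\<dots> = min (base_cdf p) (1 - base_cdf p)" by (simp add: t min.commute)
  also have "\<dots> = (1 - \<bar>p\<bar>)\<^sup>2 / 2"
  proof -
    have "(1 - \<bar>p\<bar>)\<^sup>2 \<le> 1" using assms by (auto intro!: power_le_one)
    then show ?thesis by (cases "0 \<le> p") (auto simp: base_cdf_nonneg base_cdf_nonpos min_def)
  qed
  finally show ?thesis by simp
qed

lemma quantile_sgn:
  assumes "p \<in> {-1<..<1}"
  shows "0 < p \<Longrightarrow> 0 < quantile p" "p < 0 \<Longrightarrow> quantile p < 0"
proof -
  have c0: "cdf M 0 = 1 / 2" using cdf_plus_tail[OF nondegenerate, of 0] tail_0[OF nondegenerate] by simp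
  have sq: "(1 - t)\<^sup>2 < 1" if "0 < t" "t < 1" for t :: real
    using power_strict_mono[of "1 - t" 1 2] that by simp
  show "0 < quantile p" if "0 < p"
    using sq[of p] that assms quantile_le_iff[OF assms, of 0] c0 by (auto simp: base_cdf_nonneg not_le[symmetric])
  show "quantile p < 0" if "p < 0"
  proof (rule ccontr)
    assume "\<not> quantile p < 0"
    then have "cdf M 0 \<le> cdf M (quantile p)" by (intro cdf_nondecreasing) auto
    then show False using sq[of "- p"] that assms c0 by (simp add: cdf_quantile base_cdf_nonpos)
  qed
qed

text \<open>
  Write \<open>s = 1 - \<bar>p\<bar> \<le> t = 1 - \<bar>q\<bar>\<close>.  If \<open>p\<close> and \<open>q\<close> have opposite signs, the ratio is
  \<open>(2 + s - t)\<^sup>2 / (4 s t)\<close>, which is smallest at \<open>t = 1\<close>, and \<open>s \<le> \<tau>\<close> because one of the two points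
  is at distance at least \<open>a\<close> from the origin.  If they have the same sign, the ratio depends only on
  \<open>s / t\<close>, and submultiplicativity of the tail gives \<open>s / t \<le> \<tau>\<close>.  In both cases the monotonicity of
  \<open>(1 + x)\<^sup>2 / (4 x)\<close> on \<open>(0, 1]\<close> finishes the proof.
\<close>

lemma tail_ratio_le_base_ratio_aux:
  assumes p: "p \<in> {-1<..<1}" and q: "q \<in> {-1<..<1}" and pq: "\<bar>q\<bar> \<le> \<bar>p\<bar>"
  defines "a \<equiv> \<bar>quantile p - quantile q\<bar> / 2"
  defines "\<tau> \<equiv> sqrt (2 * tail a)"
  shows "0 < tail a" "(1 + \<tau>)\<^sup>2 / (4 * \<tau>) \<le> base_ratio p q"
proof -
  define x y where "x = quantile p" and "y = quantile q"
  define s t where "s = 1 - \<bar>p\<bar>" and "t = 1 - \<bar>q\<bar>"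
  have st: "0 < s" "s \<le> t" "t \<le> 1" using p q pq by (auto simp: s_def t_def)
  have tx: "2 * tail \<bar>x\<bar> = s\<^sup>2" and ty: "2 * tail \<bar>y\<bar> = t\<^sup>2"
    using tail_quantile p q by (auto simp: x_def y_def s_def t_def)
  have a: "0 \<le> a" "a \<le> \<bar>x\<bar> \<or> a \<le> \<bar>y\<bar>" by (auto simp: a_def x_def y_def)
  have s2: "s\<^sup>2 \<le> 2 * tail a"
  proof -
    have "s\<^sup>2 \<le> t\<^sup>2" using st by (intro power_mono) auto
    then show ?thesis using a(2) tail_antimono[of a "\<bar>x\<bar>"] tail_antimono[of a "\<bar>y\<bar>"] tx ty by auto
  qed
  show pos: "0 < tail a" using s2 st zero_less_power[of s 2] by linarith
  have \<tau>1: "\<tau> \<le> 1" using tail_le_half[OF nondegenerate a(1)] by (simp add: \<tau>_def)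
  consider "p = q" | "p * q \<le> 0" | "p \<noteq> q" "0 < p * q" by linarith
  then show "(1 + \<tau>)\<^sup>2 / (4 * \<tau>) \<le> base_ratio p q"
  proof cases
    case 1
    then have "\<tau> = 1" by (simp add: \<tau>_def a_def tail_0[OF nondegenerate])
    then show ?thesis using base_ratio_ge_1[OF p q] by simp
  next
    case 2
    have "s \<le> \<tau>" unfolding \<tau>_def using s2 st real_le_rsqrt by blast
    then have "(1 + \<tau>)\<^sup>2 / (4 * \<tau>) \<le> (1 + s)\<^sup>2 / (4 * s)"
      using st \<tau>1 by (intro power_mean_ratio_antimono) auto
    also have "\<dots> = ((1 + s) / 2)\<^sup>2 / s" by (simp add: power_divide)
    also have "\<dots> \<le> (1 - \<bar>(p + q) / 2\<bar>)\<^sup>2 / (s * t)"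
    proof (intro frac_le power_mono)
      have "\<bar>p + q\<bar> = \<bar>p\<bar> - \<bar>q\<bar>" using 2 pq by (auto simp: mult_le_0_iff abs_if)
      then show "(1 + s) / 2 \<le> 1 - \<bar>(p + q) / 2\<bar>" using st by (simp add: s_def)
    qed (use st in \<open>auto simp: mult_left_le\<close>)
    finally show ?thesis by (simp add: base_ratio_def s_def t_def)
  next
    case 3
    have sgn: "(0 < p \<and> 0 < q \<and> 0 < x \<and> 0 < y) \<or> (p < 0 \<and> q < 0 \<and> x < 0 \<and> y < 0)"
      using 3(2) quantile_sgn p q by (auto simp: zero_less_mult_iff x_def y_def)
    have "s \<noteq> t" using 3(1) sgn by (auto simp: s_def t_def)
    then have "s\<^sup>2 < t\<^sup>2" using st by (intro power_strict_mono) auto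
    then have xy: "\<bar>y\<bar> \<le> \<bar>x\<bar>" using tail_antimono[of "\<bar>x\<bar>" "\<bar>y\<bar>"] tx ty by linarith
    define d where "d = \<bar>x\<bar> - \<bar>y\<bar>"
    have "2 * a = d" using sgn xy by (auto simp: a_def d_def x_def[symmetric] y_def[symmetric])
    then have ad: "a \<le> d" using a by simp
    have "2 * (tail \<bar>x\<bar> * tail 0) * 2 \<le> 2 * (tail \<bar>y\<bar> * tail d) * 2"
      using tail_submult[of "\<bar>y\<bar>" "\<bar>x\<bar>"] xy by (simp add: d_def)
    then have "s\<^sup>2 \<le> t\<^sup>2 * (2 * tail d)"
      unfolding ty[symmetric] using tx by (simp add: tail_0[OF nondegenerate])
    also have "\<dots> \<le> t\<^sup>2 * (2 * tail a)" using tail_antimono[OF ad] by (intro mult_left_mono) auto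
    finally have "(s / t)\<^sup>2 \<le> 2 * tail a" using st by (simp add: power_divide field_simps)
    then have "s / t \<le> \<tau>" unfolding \<tau>_def using real_le_rsqrt by blast
    then have "(1 + \<tau>)\<^sup>2 / (4 * \<tau>) \<le> (1 + s / t)\<^sup>2 / (4 * (s / t))"
      using st \<tau>1 by (intro power_mean_ratio_antimono) auto
    also have "\<dots> = ((s + t) / 2)\<^sup>2 / (s * t)"
      using st by (simp add: field_simps power2_eq_square)
    also have "(s + t) / 2 = 1 - \<bar>(p + q) / 2\<bar>" using sgn by (auto simp: s_def t_def)
    finally show ?thesis by (simp add: base_ratio_def s_def t_def)
  qed
qed

lemma tail_ratio_le_base_ratio:
  assumes "p \<in> {-1<..<1}" "q \<in> {-1<..<1}"
  defines "a \<equiv> \<bar>quantile p - quantile q\<bar> / 2"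
  defines "\<tau> \<equiv> sqrt (2 * tail a)"
  shows "0 < tail a" "(1 + \<tau>)\<^sup>2 / (4 * \<tau>) \<le> base_ratio p q"
  using tail_ratio_le_base_ratio_aux[of p q] tail_ratio_le_base_ratio_aux[of q p] assms
  by (auto simp: abs_minus_commute base_ratio_commute linorder_not_le intro: linorder_le_cases[of "\<bar>q\<bar>" "\<bar>p\<bar>"])

end
end

section \<open>The infimum convolution inequality\<close>

lemma exp_ereal_mono: "x \<le> y \<Longrightarrow> exp_ereal x \<le> exp_ereal y"
  by (cases x; cases y) (auto simp: exp_ereal_def intro: ennreal_leI)

lemma ln_ennreal_ennreal: "0 < e \<Longrightarrow> ln_ennreal (ennreal e) = ereal (ln e)"
  by (simp add: ln_ennreal_def)

lemma log_laplace_conjugate_le: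
  assumes "0 < R"
    and mgf: "\<And>u. ennreal (exp (u * v)) \<le> (\<integral>\<^sup>+x. ennreal (exp (u * x)) \<partial>M) * ennreal R"
  shows "log_laplace_conjugate M v \<le> ereal (ln R)"
  unfolding log_laplace_conjugate_def
proof (rule SUP_least)
  fix u
  show "ereal (v * u) - log_laplace M u \<le> ereal (ln R)"
  proof (cases "\<integral>\<^sup>+x. ennreal (exp (u * x)) \<partial>M")
    case top
    then show ?thesis by (simp add: log_laplace_def ln_ennreal_def)
  next
    case (real e)
    have le: "exp (u * v) \<le> e * R"
      using mgf[of u] real \<open>0 < R\<close> by (simp add: ennreal_mult[symmetric] ennreal_le_iff)
    then have "0 < e * R" using exp_gt_zero less_le_trans by blast
    then have "0 < e" using \<open>0 < R\<close> by (simp add: zero_less_mult_iff)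
    have "u * v \<le> ln (e * R)" using le \<open>0 < e * R\<close> by (simp add: ln_ge_iff)
    also have "\<dots> = ln e + ln R" using \<open>0 < e\<close> \<open>0 < R\<close> by (simp add: ln_mult)
    finally show ?thesis
      using \<open>0 < e\<close> real by (simp add: log_laplace_def ln_ennreal_ennreal mult.commute)
  qed
qed

context symmetric_log_concave
begin

lemma log_laplace_nonneg: "0 \<le> log_laplace M u"
proof (cases "\<integral>\<^sup>+x. ennreal (exp (u * x)) \<partial>M")
  case (real e)
  then have "1 \<le> e" using mgf_ge_1[of u] by (simp flip: ennreal_1)
  then show ?thesis using real by (simp add: log_laplace_def ln_ennreal_ennreal)
qed (simp add: log_laplace_def ln_ennreal_def)

lemma log_laplace_0: "log_laplace M 0 = 0"
  using emeasure_space_1 by (simp add: log_laplace_def ln_ennreal_def)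

lemma log_laplace_conjugate_nonneg: "0 \<le> log_laplace_conjugate M v"
proof -
  have "ereal (v * 0) - log_laplace M 0 \<le> log_laplace_conjugate M v"
    unfolding log_laplace_conjugate_def by (rule SUP_upper) simp
  then show ?thesis by (simp add: log_laplace_0 zero_ereal_def[symmetric])
qed

text \<open>
  As a supremum of continuous functions the conjugate is lower semicontinuous.
\<close>

lemma log_laplace_conjugate_measurable: "log_laplace_conjugate M \<in> borel_measurable borel"
proof (rule borel_measurable_ereal_iff_Ioi[THEN iffD2], rule allI)
  fix c :: ereal
  have "log_laplace_conjugate M -` {c<..} \<inter> space borel = (\<Union>u. {v. c < ereal (v * u) - log_laplace M u})"
    by (auto simp: log_laplace_conjugate_def less_SUP_iff)
  also have "open \<dots>"
  proof (intro open_UN ballI)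
    fix u
    have "open {v. c < ereal (v * u) - ereal r}" for r
      by (simp, intro open_Collect_less continuous_intros)
    then show "open {v. c < ereal (v * u) - log_laplace M u}"
      using log_laplace_nonneg[of u] by (cases "log_laplace M u") auto
  qed
  then have "(\<Union>u. {v. c < ereal (v * u) - log_laplace M u}) \<in> sets borel" by (rule borel_open)
  finally show "log_laplace_conjugate M -` {c<..} \<inter> space borel \<in> sets borel" .
qed

text \<open>
  The comparison of costs.  The factor \<open>48\<close> is \<open>2 \<cdot> 24\<close>: the tail is compared at half the distance of the
  two points, and the Laplace transform is controlled up to the factor \<open>24\<close>.
\<close>

lemma log_laplace_conjugate_quantile_le:
  assumes p: "p \<in> {-1<..<1}" and q: "q \<in> {-1<..<1}"
  shows "log_laplace_conjugate M ((quantile p - quantile q) / 48) \<le> ereal (ln (base_ratio p q))"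
proof (rule log_laplace_conjugate_le)
  show pos: "0 < base_ratio p q" using base_ratio_ge_1[OF p q] by simp
  fix u :: real
  let ?E = "\<lambda>u. \<integral>\<^sup>+x. ennreal (exp (u * x)) \<partial>M"
  show "ennreal (exp (u * ((quantile p - quantile q) / 48))) \<le> ?E u * ennreal (base_ratio p q)"
  proof (cases "measure M {0} = 1")
    case True
    have "1 * ennreal 1 \<le> ?E u * ennreal (base_ratio p q)"
      using base_ratio_ge_1[OF p q] by (intro mult_mono mgf_ge_1 ennreal_leI) auto
    then show ?thesis using quantile_degenerate[OF True] p q by simp
  next
    case False
    define a where "a = \<bar>quantile p - quantile q\<bar> / 2"
    define \<tau> where "\<tau> = sqrt (2 * tail a)"
    define w where "w = (if quantile q \<le> quantile p then u else - u)"
    have "u * ((quantile p - quantile q) / 48) = w * a / 24" by (simp add: w_def a_def abs_if algebra_simps)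
    then have "ennreal (exp (u * ((quantile p - quantile q) / 48))) = ennreal (exp (w * a / 24))" by simp
    also have "\<dots> \<le> ?E w * ennreal ((1 + \<tau>)\<^sup>2 / (4 * \<tau>))"
      unfolding \<tau>_def using tail_ratio_le_base_ratio(1)[OF False p q]
      by (intro mgf_lower_bound False) (auto simp: a_def)
    also have "\<dots> \<le> ?E w * ennreal (base_ratio p q)"
      using tail_ratio_le_base_ratio(2)[OF False p q] by (intro mult_left_mono ennreal_leI) (auto simp: \<tau>_def a_def)
    also have "?E w = ?E u" unfolding mgf_eq_cosh by (simp add: w_def)
    finally show ?thesis .
  qed
qed

text \<open>
  The infimum convolution need not be Borel.  However, the pointwise hypothesis of the
  Prekopa--Leindler inequality is inherited by every Borel function below its exponential, and the
  integral is the supremum over simple functions of this kind.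
\<close>

lemma property_tau_borel_minorant:
  fixes f :: "real \<Rightarrow> real" and g :: "real \<Rightarrow> ennreal"
  assumes [measurable]: "f \<in> borel_measurable borel" and bnd: "bounded (range f)"
    and [measurable]: "g \<in> borel_measurable borel"
    and g: "\<And>x. g x \<le> exp_ereal (inf_convolution (\<lambda>z. ereal (f z)) (\<lambda>v. log_laplace_conjugate M (v / 48)) x)"
  shows "(\<integral>\<^sup>+x. g x \<partial>M) * (\<integral>\<^sup>+x. ennreal (exp (- f x)) \<partial>M) \<le> 1"
proof -
  \<comment> \<open>The factor \<open>ind\<close> inside \<open>enn2real\<close> makes \<open>h\<close> and \<open>k\<close> measurable: \<open>quantile\<close> is controlled on \<open>(-1, 1)\<close> only.\<close>
  define ind :: "real \<Rightarrow> ennreal" where "ind = indicator {-1<..<1}"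
  define h where "h p = enn2real (g (quantile p) * ind p) * ((1 - \<bar>p\<bar>) * indicator {-1<..<1} p)" for p
  define k where "k p = enn2real (ennreal (exp (- f (quantile p))) * ind p) * ((1 - \<bar>p\<bar>) * indicator {-1<..<1} p)" for p
  define r where "r p = (1 - \<bar>p\<bar>) * indicator {-1<..<1} p" for p :: real
  obtain B where B: "\<bar>f x\<bar> \<le> B" for x using bnd by (auto simp: bounded_iff)
  have main: "g (quantile p) \<le> ennreal (exp (f (quantile q)) * base_ratio p q)"
    if p: "p \<in> {-1<..<1}" and q: "q \<in> {-1<..<1}" for p q
  proof -
    let ?x = "quantile p" and ?y = "quantile q"
    have "g ?x \<le> exp_ereal (inf_convolution (\<lambda>z. ereal (f z)) (\<lambda>v. log_laplace_conjugate M (v / 48)) ?x)" by (rule g)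
    also have "\<dots> \<le> exp_ereal (ereal (f ?y) + ereal (ln (base_ratio p q)))"
    proof (rule exp_ereal_mono)
      have "inf_convolution (\<lambda>z. ereal (f z)) (\<lambda>v. log_laplace_conjugate M (v / 48)) ?x
          \<le> ereal (f (?x - (?x - ?y))) + log_laplace_conjugate M ((?x - ?y) / 48)"
        unfolding inf_convolution_def by (rule INF_lower) simp
      also have "\<dots> \<le> ereal (f ?y) + ereal (ln (base_ratio p q))"
        using add_left_mono[OF log_laplace_conjugate_quantile_le[OF p q], of "ereal (f ?y)"] by simp
      finally show "inf_convolution (\<lambda>z. ereal (f z)) (\<lambda>v. log_laplace_conjugate M (v / 48)) ?x
          \<le> ereal (f ?y) + ereal (ln (base_ratio p q))" .
    qed
    also have "\<dots> = ennreal (exp (f ?y) * base_ratio p q)"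
      using base_ratio_ge_1[OF p q] by (simp add: exp_ereal_def exp_add)
    finally show ?thesis .
  qed
  have g_fin: "g (quantile p) < \<top>" if "p \<in> {-1<..<1}" for p
    using main[OF that that] by (rule le_less_trans) simp
  have main_real: "enn2real (g (quantile p)) \<le> exp (f (quantile q)) * base_ratio p q"
    if "p \<in> {-1<..<1}" "q \<in> {-1<..<1}" for p q
    using main[OF that] base_ratio_ge_1[OF that] by (intro enn2real_leI) auto
  have int_h: "(\<integral>\<^sup>+x. g x \<partial>M) = (\<integral>\<^sup>+p. ennreal (h p) \<partial>lborel)"
    unfolding nn_integral_quantile[OF assms(3)]
    using g_fin by (intro nn_integral_cong) (auto simp: h_def ind_def ennreal_mult' split: split_indicator)
  have int_k: "(\<integral>\<^sup>+x. ennreal (exp (- f x)) \<partial>M) = (\<integral>\<^sup>+p. ennreal (k p) \<partial>lborel)"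
    by (subst nn_integral_quantile, measurable, intro nn_integral_cong)
       (auto simp: k_def ind_def ennreal_mult' split: split_indicator)
  have int_r: "(\<integral>\<^sup>+p. ennreal (r p) \<partial>lborel) = 1"
  proof -
    have "1 = (\<integral>\<^sup>+x. 1 \<partial>M)" using emeasure_space_1 by simp
    also have "\<dots> = (\<integral>\<^sup>+p. ennreal (r p) \<partial>lborel)"
      by (subst nn_integral_quantile, measurable, intro nn_integral_cong) (auto simp: r_def split: split_indicator)
    finally show ?thesis ..
  qed
  have "(\<integral>\<^sup>+p. ennreal (h p) \<partial>lborel) * (\<integral>\<^sup>+p. ennreal (k p) \<partial>lborel) \<le> (\<integral>\<^sup>+p. ennreal (r p) \<partial>lborel)\<^sup>2"
  proof (rule prekopa_leindler_midpoint)
    have [measurable]: "(\<lambda>p. g (quantile p) * ind p) \<in> borel_measurable borel"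
      "(\<lambda>p. ennreal (exp (- f (quantile p))) * ind p) \<in> borel_measurable borel"
      unfolding ind_def using quantile_measurable(1)[of g] quantile_measurable(1)[of "\<lambda>x. ennreal (exp (- f x))"] by auto
    show "h \<in> borel_measurable borel" unfolding h_def[abs_def] by measurable
    show "k \<in> borel_measurable borel" unfolding k_def[abs_def] by measurable
    show "r \<in> borel_measurable borel" unfolding r_def[abs_def] by measurable
    show h0: "0 \<le> h p" and k0: "0 \<le> k p" and r0: "0 \<le> r p" for p
      by (auto simp: h_def k_def r_def split: split_indicator)
    have "h p \<le> exp B" for p
    proof (cases "p \<in> {-1<..<1}")
      case True
      then have "\<bar>p\<bar> < 1" by auto
      then have "base_ratio p p = 1" by (simp add: base_ratio_def power2_eq_square)
      then have "enn2real (g (quantile p)) \<le> exp (f (quantile p))" using main_real[OF True True] by simp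
      also have "\<dots> \<le> exp B" using B[of "quantile p"] by simp
      finally have "enn2real (g (quantile p)) * (1 - \<bar>p\<bar>) \<le> exp B * 1" using True by (intro mult_mono) auto
      then show ?thesis using True by (simp add: h_def ind_def)
    qed (simp add: h_def)
    then show "bdd_above (range h)" by (rule bdd_aboveI2)
    have "k p \<le> exp B" for p
    proof (cases "p \<in> {-1<..<1}")
      case True
      have "exp (- f (quantile p)) * (1 - \<bar>p\<bar>) \<le> exp B * 1" using B[of "quantile p"] True by (intro mult_mono) auto
      then show ?thesis using True by (simp add: k_def ind_def)
    qed (simp add: k_def)
    then show "bdd_above (range k)" by (rule bdd_aboveI2)
    fix p q
    show "h p * k q \<le> (r ((p + q) / 2))\<^sup>2"
    proof (cases "p \<in> {-1<..<1} \<and> q \<in> {-1<..<1}")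
      case True
      then have p: "p \<in> {-1<..<1}" and q: "q \<in> {-1<..<1}" by auto
      let ?P = "(1 - \<bar>p\<bar>) * (1 - \<bar>q\<bar>)"
      have pos: "0 < ?P" using p q by auto
      have "h p * k q = enn2real (g (quantile p)) * (exp (- f (quantile q)) * ?P)"
        using p q by (simp add: h_def k_def ind_def)
      also have "\<dots> \<le> (exp (f (quantile q)) * base_ratio p q) * (exp (- f (quantile q)) * ?P)"
        using pos by (intro mult_right_mono main_real p q) auto
      also have "\<dots> = base_ratio p q * ?P" by (simp add: exp_minus)
      also have "\<dots> = (1 - \<bar>(p + q) / 2\<bar>)\<^sup>2" using pos by (auto simp: base_ratio_def)
      also have "\<dots> = (r ((p + q) / 2))\<^sup>2" using p q by (simp add: r_def)
      finally show ?thesis .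
    qed (auto simp: h_def k_def)
  qed
  then show ?thesis by (simp add: int_h int_k int_r)
qed

lemma IC_48: "satisfies_IC M 48"
  unfolding satisfies_IC_def property_tau_def
proof (intro conjI allI impI)
  show "(\<lambda>v. log_laplace_conjugate M (v / 48)) \<in> borel_measurable borel"
    using measurable_compose[OF _ log_laplace_conjugate_measurable, of "\<lambda>v. v / 48" borel] by simp
  show "0 \<le> log_laplace_conjugate M (x / 48)" for x by (rule log_laplace_conjugate_nonneg)
  fix f :: "real \<Rightarrow> real" assume f: "f \<in> borel_measurable borel" "bounded (range f)"
  let ?F = "\<lambda>x. exp_ereal (inf_convolution (\<lambda>z. ereal (f z)) (\<lambda>v. log_laplace_conjugate M (v / 48)) x)"
  have "integral\<^sup>S M g * (\<integral>\<^sup>+x. ennreal (exp (- f x)) \<partial>M) \<le> 1" if "simple_function M g" "g \<le> ?F" for g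
  proof -
    have "g \<in> borel_measurable borel"
      using borel_measurable_simple_function[OF that(1)] by simp
    then show ?thesis
      using property_tau_borel_minorant[OF f, of g] that
      by (simp add: nn_integral_eq_simple_integral le_fun_def)
  qed
  then show "(\<integral>\<^sup>+x. ?F x \<partial>completion M) * (\<integral>\<^sup>+x. ennreal (exp (- f x)) \<partial>M) \<le> 1"
    unfolding nn_integral_completion nn_integral_def[of M ?F]
    by (subst SUP_mult_right_ennreal) (auto intro!: SUP_least)
qed simp

end

theorem theorem2p18:
  fixes M :: "real measure"
  assumes "real_distribution M"
    and "symmetric_measure M"
    and "log_concave_measure M"
  shows "satisfies_IC M 48"
proof -
  interpret symmetric_log_concave M
    using assms by (simp add: symmetric_log_concave_def symmetric_log_concave_axioms_def)
  show ?thesis by (rule IC_48)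
qed

end
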